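(* Let $t\ge 4$ and $n$ be integers with $n\ge \frac{11}{12}\,2^{t-1}+2t+\frac{1}{3}$. Then $\chi_c(M^t(K_n))=\chi(M^t(K_n))=n+t$.
   Context: For integers $k\ge 2d\ge 2$, a $(k,d)$-coloring of a graph $G$ is a map $f:V(G)\to\{0,1,\dots,k-1\}$ such that $d\le |f(u)-f(v)|\le k-d$ for every edge $uv$. The circular chromatic number is $\chi_c(G)=\inf\{k/d:\ G \text{ has a } (k,d)\text{-coloring}\}$; $\chi(G)$ is the ordinary chromatic number. For a simple graph $G$ with $V(G)=\{x_1,\dots,x_n\}$, the Mycielski graph $M(G)$ has vertex set $\{x_1,\dots,x_n\}\cup\{x_1',\dots,x_n'\}\cup\{u\}$ and edge set $E(G)\cup\{x_i'x_j: x_ix_j\in E(G)\}\cup\{ux_i':1\le i\le n\}$. Set $M^0(G)=G$ and $M^t(G)=M(M^{t-1}(G))$. $K_n$ is the complete graph on $n$ vertices. *)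

theory Defs
  imports Complex_Main "HOL-Library.FuncSet" "Graph_Theory.Graph_Theory"
begin

text \<open>
  Finite simple graphs are represented as in the session Graph_Theory: by symmetric, loop-free,
  finite pair digraphs (locale \<^locale>\<open>pair_graph\<close>), an undirected edge \<open>xy\<close> being the two arcs
  \<open>(x, y)\<close> and \<open>(y, x)\<close>. Complete graphs are given by the predicate \<^const>\<open>complete_digraph\<close>.
\<close>

definition circular_coloring :: "int \<Rightarrow> int \<Rightarrow> 'a pair_pre_digraph \<Rightarrow> ('a \<Rightarrow> int) \<Rightarrow> bool" where
  "circular_coloring k d G f \<longleftrightarrow>
     f \<in> pverts G \<rightarrow> {0..k - 1} \<and>
     (\<forall>(u, v) \<in> parcs G. d \<le> \<bar>f u - f v\<bar> \<and> \<bar>f u - f v\<bar> \<le> k - d)"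

definition circular_chromatic_number :: "'a pair_pre_digraph \<Rightarrow> real" where
  "circular_chromatic_number G =
     Inf {real_of_int k / real_of_int d | k d.
            k \<ge> 2 * d \<and> 2 * d \<ge> 2 \<and> (\<exists>f. circular_coloring k d G f)}"

definition proper_coloring :: "nat \<Rightarrow> 'a pair_pre_digraph \<Rightarrow> ('a \<Rightarrow> nat) \<Rightarrow> bool" where
  "proper_coloring m G f \<longleftrightarrow>
     f \<in> pverts G \<rightarrow> {..<m} \<and> (\<forall>(u, v) \<in> parcs G. f u \<noteq> f v)"

definition chromatic_number :: "'a pair_pre_digraph \<Rightarrow> nat" where
  "chromatic_number G = (LEAST m. \<exists>f. proper_coloring m G f)"

text \<open>
  The Mycielski construction adds new vertices, so in order to iterate it within one type the
  vertices are taken from the following datatype. The vertex \<open>x\<^sub>i\<close> of \<open>G\<close> becomes \<open>Orig x\<^sub>i\<close> in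
  \<open>M(G)\<close>, its copy \<open>x\<^sub>i'\<close> is \<open>Twin x\<^sub>i\<close>, and \<open>u\<close> is \<open>Apex\<close>; as the constructors are free, these are
  pairwise distinct. \<open>Base\<close> provides names for the vertices of the initial graph.
\<close>

datatype 'a vert = Base 'a | Orig "'a vert" | Twin "'a vert" | Apex

definition mycielskian :: "'a vert pair_pre_digraph \<Rightarrow> 'a vert pair_pre_digraph" where
  "mycielskian G =
     \<lparr> pverts = Orig ` pverts G \<union> Twin ` pverts G \<union> {Apex},
       parcs = {(Orig x, Orig y) | x y. (x, y) \<in> parcs G}
             \<union> {(Twin x, Orig y) | x y. (x, y) \<in> parcs G}
             \<union> {(Orig y, Twin x) | x y. (x, y) \<in> parcs G}
             \<union> {(Apex, Twin x) | x. x \<in> pverts G}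
             \<union> {(Twin x, Apex) | x. x \<in> pverts G} \<rparr>"

lemma pair_graph_mycielskian:
  assumes "pair_graph G"
  shows "pair_graph (mycielskian G)"
proof -
  interpret G: pair_graph G by fact
  have fin: "finite (pverts (mycielskian G))"
    by (simp add: mycielskian_def G.pair_finite_verts)
  have sub: "parcs (mycielskian G) \<subseteq> pverts (mycielskian G) \<times> pverts (mycielskian G)"
    by (auto simp: mycielskian_def dest: G.in_arcsD1 G.in_arcsD2)
  have sym: "(y, x) \<in> parcs G" if "(x, y) \<in> parcs G" for x y
    using G.pair_sym_arcs that by (metis symD symmetric_def with_proj_simps(3))
  have irr: "(x, x) \<notin> parcs G" for x
    using G.pair_no_loops[of "(x, x)"] by auto
  show ?thesis
  proof unfold_locales
    show "finite (parcs (mycielskian G))"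
      using sub fin by (meson finite_SigmaI finite_subset)
    show "symmetric (with_proj (mycielskian G))"
      unfolding symmetric_def
      by (rule symI) (auto simp: mycielskian_def intro: sym)
    show "finite (pverts (mycielskian G))" by (fact fin)
    show "fst e \<in> pverts (mycielskian G)" "snd e \<in> pverts (mycielskian G)"
      if "e \<in> parcs (mycielskian G)" for e
      using subsetD[OF sub that] by (simp_all add: mem_Times_iff)
    show "fst e \<noteq> snd e" if "e \<in> parcs (mycielskian G)" for e
      using that by (auto simp: mycielskian_def irr)
  qed
qed

lemma complete_digraph_vert_exists: "\<exists>G :: 'a vert pair_pre_digraph. K\<^bsub>n\<^esub> (with_proj G)"
proof -
  have "inj (\<lambda>i. (Orig ^^ i) (Apex :: 'a vert))"
  proof (rule injI)
    fix i j assume "(Orig ^^ i) (Apex :: 'a vert) = (Orig ^^ j) Apex"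
    then show "i = j"
    proof (induction i arbitrary: j)
      case 0 then show ?case by (cases j) auto
    next
      case (Suc i) then show ?case by (cases j) auto
    qed
  qed
  then have "infinite (UNIV :: 'a vert set)"
    by (meson finite_subset range_inj_infinite subset_UNIV)
  then obtain V :: "'a vert set" where "finite V" "card V = n"
    using infinite_arbitrarily_large by blast
  then have "K\<^bsub>n\<^esub> (with_proj \<lparr> pverts = V, parcs = {(u, v). (u, v) \<in> V \<times> V \<and> u \<noteq> v} \<rparr>)"
    by (simp add: complete_digraph_pair_def)
  then show ?thesis by blast
qed

end

theory Submission
  imports Defs
begin

text \<open>
  Suppose that \<open>M\<^sup>t(K\<^sub>n)\<close> has a \<open>(k, d)\<close>-coloring with \<open>k < (n + t) d\<close>, and take \<open>d\<close> minimal. Then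
  \<open>k\<close> and \<open>d\<close> are coprime, \<open>d \<ge> 2\<close>, and every \<open>(k, d)\<close>-coloring uses all \<open>k\<close> colors: if a color is
  avoided, rounding \<open>c k' / k\<close> with \<open>d' k - k' d = 1\<close> gives a \<open>(k', d')\<close>-coloring with \<open>d' < d\<close>.

  Call two colors close if they are not allowed on an edge. A copy of a vertex \<open>x\<close> of \<open>K\<^sub>n\<close> is adjacent
  to all other vertices of \<open>K\<^sub>n\<close>, so a color close to the colors of two of them must occur on a
  descendant of an apex. Double counting shows that there are at least \<open>n (2 d - 1) - k\<close> such
  colors. On the other hand, one may recolor each twin of the last step like its original unless the
  original is close to the last apex; hence, up to \<open>2 d - 1\<close> colors, the descendants of apexes
  realize at most \<open>2\<^sup>t\<^sup>-\<^sup>1 - 1\<close> of them. This settles \<open>d \<ge> 3\<close>.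

  If \<open>d = 2\<close>, the count misses a contradiction by less than a twelfth of \<open>2\<^sup>t\<^sup>-\<^sup>1\<close>. If each of the eight
  vertices over some apex descendant in \<open>M\<^sup>t\<^sup>-\<^sup>3(K\<^sub>n)\<close> shared its color at most with its twin in the
  last step, then recoloring a few of them would vacate a color. So the \<open>2\<^sup>t\<^sup>-\<^sup>3 - 1\<close> such descendants
  cause losses, and each lost color accounts for at most three of them.
\<close>

subsection \<open>Minimal denominators\<close>

text \<open>For colors in \<open>{0..<k}\<close> this says that their circular distance on the cycle
  of length \<open>k\<close> is at least \<open>d\<close>.\<close>

definition far :: "int \<Rightarrow> int \<Rightarrow> int \<Rightarrow> int \<Rightarrow> bool" where
  "far k d a b \<longleftrightarrow> d \<le> \<bar>a - b\<bar> \<and> \<bar>a - b\<bar> \<le> k - d"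

lemma far_commute: "far k d a b \<longleftrightarrow> far k d b a"
  by (auto simp: far_def abs_minus_commute)

lemma circular_coloring_iff:
  "circular_coloring k d G f \<longleftrightarrow>
     (\<forall>v \<in> pverts G. f v \<in> {0..<k}) \<and> (\<forall>u v. (u, v) \<in> parcs G \<longrightarrow> far k d (f u) (f v))"
  by (fastforce simp: circular_coloring_def far_def)

text \<open>The determinant condition makes \<open>k' / d'\<close> a lower Farey neighbor of
  \<open>k / d\<close>. Here \<open>d'\<close> is the inverse of \<open>k\<close> modulo
  \<open>d\<close>, nonzero because \<open>d\<close> does not divide 1.\<close>

lemma bezout_smaller_pair:
  fixes k d :: int
  assumes "coprime k d" "2 \<le> d"
  obtains k' d' where "1 \<le> d'" "d' < d" "d' * k - k' * d = 1"
proof -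
  obtain u v where uv: "u * k + v * d = 1"
    using bezout_int[of k d] assms(1) by (auto simp: coprime_iff_gcd_eq_1)
  define d' where "d' = u mod d"
  have "d' * k - (- v - (u div d) * k) * d = (d' + (u div d) * d) * k + v * d"
    by (simp add: algebra_simps)
  also have "\<dots> = 1"
    using uv by (simp add: d'_def)
  finally have eq: "d' * k - (- v - (u div d) * k) * d = 1" .
  have "0 \<le> d'" "d' < d"
    using assms(2) by (simp_all add: d'_def)
  moreover have "d' \<noteq> 0"
  proof
    assume "d' = 0"
    then have "d dvd 1"
      using eq by (metis dvd_diff_right_iff dvd_triv_right mult_zero_left dvd_0_right dvd_def)
    then show False
      using assms(2) by (simp add: zdvd1_eq)
  qed
  ultimately have "1 \<le> d'" "d' < d" by auto
  then show ?thesis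
    using eq by (rule that)
qed

lemma div_less_of_less_mult:
  fixes a b c :: int
  assumes "0 < c" "a < b * c"
  shows "a div c < b"
proof -
  have "a div c * c \<le> a"
    using assms(1) by (simp add: div_mult_self_is_m minus_mod_eq_div_mult[symmetric])
  then have "a div c * c < b * c" using assms(2) by linarith
  then show ?thesis
    by (simp only: mult_less_cancel_right_pos[OF assms(1)])
qed

text \<open>Rounding down drops the remainders of \<open>a * k'\<close> and \<open>b * k'\<close>
  modulo \<open>k\<close>. They are nonzero, as \<open>k\<close> and \<open>k'\<close> are coprime
  and the color 0 is excluded, so they differ by at most \<open>k - 2\<close>; the unit saved
  absorbs the determinant 1.\<close>

lemma unused_color_scaling:
  fixes a b k d k' d' :: int
  assumes det: "d' * k - k' * d = 1" and k: "0 < k" and d: "0 < d" and d': "0 < d'"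
    and a: "0 < a" "a < k" and b: "0 < b" "b < k"
    and "far k d a b"
  shows "far k' d' (a * k' div k) (b * k' div k)"
proof -
  have cop: "coprime k k'"
  proof (rule coprimeI)
    fix c assume "c dvd k" "c dvd k'"
    then have "c dvd d' * k - k' * d" by simp
    then show "is_unit c" by (simp add: det)
  qed
  have nz: "(x * k') mod k \<noteq> 0" if "0 < x" "x < k" for x
    using that cop by (metis coprime_dvd_mult_left_iff dvd_eq_mod_eq_0 zdvd_not_zless)
  have k': "0 \<le> k'"
  proof -
    have "1 * 1 \<le> d' * k"
      using k d' by (intro mult_mono) auto
    then have "0 \<le> k' * d"
      using det by linarith
    then show ?thesis
      using d by (simp add: zero_le_mult_iff)
  qed
  have main: "d' \<le> x * k' div k - y * k' div k \<and> x * k' div k - y * k' div k \<le> k' - d'"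
    if xy: "0 < x" "x < k" "0 < y" "y < k" and D: "d \<le> x - y" "x - y \<le> k - d" for x y
  proof -
    define X Y r s where "X = x * k' div k" "Y = y * k' div k" "r = (x * k') mod k" "s = (y * k') mod k"
    have X: "x * k' = X * k + r" and Y: "y * k' = Y * k + s"
      by (simp_all add: X_Y_r_s_def)
    have r: "1 \<le> r" "r \<le> k - 1" and s: "1 \<le> s" "s \<le> k - 1"
      using nz[of x] nz[of y] xy k pos_mod_bound[of k] pos_mod_sign[of k]
      unfolding X_Y_r_s_def by (smt (verit))+
    have 1: "(x - y) * k' = (X - Y) * k + (r - s)"
      using X Y by (simp add: algebra_simps)
    have "d * k' \<le> (x - y) * k'" using D k' by (intro mult_right_mono) auto
    then have "d' * k - 1 < (X - Y) * k + k - 1" using 1 det r s by (simp add: algebra_simps)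
    then have "d' * k < (X - Y + 1) * k" by (simp add: algebra_simps)
    then have low: "d' \<le> X - Y" using k by simp
    have "(x - y) * k' \<le> (k - d) * k'" using D k' by (intro mult_right_mono) auto
    then have "(X - Y) * k < (k' - d' + 1) * k" using 1 det r s by (simp add: algebra_simps)
    then have "X - Y \<le> k' - d'" using k by simp
    with low show ?thesis by (simp add: X_Y_r_s_def)
  qed
  show ?thesis
  proof (cases "b \<le> a")
    case True
    then show ?thesis
      using main[OF a b] assms(9) d d' by (auto simp: far_def)
  next
    case False
    then show ?thesis
      using main[OF b a] assms(9) d d' by (auto simp: far_def)
  qed
qed

text \<open>Rotation changes a difference by \<open>-k\<close>, 0 or \<open>k\<close>, and the
  bounds in \<open>far\<close> are symmetric under exchanging a distance with its complement to
  \<open>k\<close>.\<close>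

lemma far_shift_mod:
  fixes k d :: int
  assumes "0 < d" "a \<in> {0..<k}" "b \<in> {0..<k}" "far k d a b"
  shows "far k d ((a - p) mod k) ((b - p) mod k)"
proof -
  have k: "0 < k" using assms by auto
  define x y where "x = (a - p) mod k" "y = (b - p) mod k"
  have xy: "0 \<le> x" "x < k" "0 \<le> y" "y < k"
    using k by (simp_all add: x_y_def)
  have "(x - y) mod k = (a - b) mod k"
    by (simp add: x_y_def mod_diff_eq)
  then obtain m where m: "x - y = a - b + k * m"
    by (metis mod_eqE add.commute diff_add_cancel mult.commute group_cancel.sub1 minus_diff_eq)
  have "k * (- 2) < k * m" "k * m < k * 2"
    using m xy assms(2,3) unfolding atLeastLessThan_iff by linarith+
  then have "- 2 < m" "m < 2"
    using k by (simp_all only: mult_less_cancel_left_pos)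
  then have "m \<in> {-1, 0, 1}"
    by auto
  then show ?thesis
    using m xy assms unfolding far_def x_y_def[symmetric] by auto
qed

lemma unused_color_reduction:
  assumes col: "circular_coloring k d G f" and G: "pair_wf_digraph G"
    and kd: "coprime k d" "2 \<le> d" and p: "p \<in> {0..<k}" "p \<notin> f ` pverts G"
  obtains k' d' g where "1 \<le> d'" "d' < d" "k' * d < k * d'" "circular_coloring k' d' G g"
proof -
  interpret pair_wf_digraph G by fact
  obtain k' d' where d': "1 \<le> d'" "d' < d" and det: "d' * k - k' * d = 1"
    using bezout_smaller_pair[OF kd] .
  have k: "0 < k" using p by auto
  define h where "h v = (f v - p) mod k" for v
  have rng: "f v \<in> {0..<k}" if "v \<in> pverts G" for v
    using col that by (simp add: circular_coloring_iff)
  have h: "0 < h v" "h v < k" if v: "v \<in> pverts G" for v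
  proof -
    have "f v \<noteq> p" using p v by auto
    then have "(f v - p) mod k \<noteq> 0"
      using rng[OF v] p by (smt (verit) atLeastLessThan_iff mod_pos_pos_trivial mod_eq_0_iff_dvd zdvd_not_zless dvd_diff_commute)
    moreover have "0 \<le> h v" "h v < k" using k by (simp_all add: h_def)
    ultimately show "0 < h v" "h v < k" by (auto simp: h_def)
  qed
  have k'0: "0 \<le> k'"
  proof -
    have "1 * 1 \<le> d' * k"
      using k d' by (intro mult_mono) auto
    then have "0 \<le> k' * d"
      using det by linarith
    then show ?thesis
      using kd by (simp add: zero_le_mult_iff)
  qed
  \<comment> \<open>\<open>k' = 0\<close> would force \<open>k = 1\<close>, leaving no nonzero color
    for \<open>v\<close>.\<close>
  have k'pos: "0 < k'" if "v \<in> pverts G" for v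
  proof (rule ccontr)
    assume "\<not> 0 < k'"
    then have "d' * k = 1" using det k'0 by simp
    then have "k = 1" using k d' by (simp add: zmult_eq_1_iff)
    then show False using h[OF that] by simp
  qed
  have "circular_coloring k' d' G (\<lambda>v. h v * k' div k)"
    unfolding circular_coloring_iff
  proof (intro conjI ballI allI impI)
    fix v assume v: "v \<in> pverts G"
    have "h v * k' < k * k'" using h[OF v] k'pos[OF v] by simp
    then have "h v * k' div k < k'" using k by (intro div_less_of_less_mult) (simp_all add: mult.commute)
    moreover have "0 \<le> h v * k' div k"
      using h[OF v] k k'0 by (simp add: pos_imp_zdiv_nonneg_iff)
    ultimately show "h v * k' div k \<in> {0..<k'}" by simp
  next
    fix u v assume uv: "(u, v) \<in> parcs G"
    then have V: "u \<in> pverts G" "v \<in> pverts G" by (auto dest: in_arcsD1 in_arcsD2)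
    have "far k d (f u) (f v)" using col uv by (simp add: circular_coloring_iff)
    then have "far k d (h u) (h v)"
      unfolding h_def using far_shift_mod rng V kd by auto
    then show "far k' d' (h u * k' div k) (h v * k' div k)"
      using unused_color_scaling[OF det k _ _ h[OF V(1)] h[OF V(2)]] kd d' by simp
  qed
  moreover have "k' * d < k * d'" using det by (simp add: mult.commute)
  ultimately show ?thesis using that d' by blast
qed

text \<open>Adding \<open>g * c\<close> raises the quotient by exactly \<open>c\<close>, and both
  distance bounds are multiples of \<open>g\<close>, so monotonicity of \<open>div\<close> transfers
  them.\<close>

lemma circular_coloring_div:
  assumes "circular_coloring (g * k) (g * d) G f" "0 < g"
  shows "circular_coloring k d G (\<lambda>v. f v div g)"
  unfolding circular_coloring_iff
proof (intro conjI ballI allI impI)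
  fix v assume "v \<in> pverts G"
  then show "f v div g \<in> {0..<k}"
    using assms by (auto simp: circular_coloring_iff pos_imp_zdiv_nonneg_iff mult.commute
        intro!: div_less_of_less_mult)
next
  fix u v assume "(u, v) \<in> parcs G"
  then have f: "far (g * k) (g * d) (f u) (f v)" using assms by (simp add: circular_coloring_iff)
  have main: "d \<le> a div g - b div g \<and> a div g - b div g \<le> k - d"
    if D: "g * d \<le> a - b" "a - b \<le> g * k - g * d" for a b
  proof -
    have "(b + g * d) div g \<le> a div g" "a div g \<le> (b + g * (k - d)) div g"
      using D assms(2) by (intro zdiv_mono1; simp add: algebra_simps)+
    then show ?thesis using assms(2) by simp
  qed
  have mono: "a div g \<le> b div g" if "a \<le> b" for a b
    using that assms(2) by (rule zdiv_mono1)
  show "far k d (f u div g) (f v div g)"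
    using f main[of "f u" "f v"] main[of "f v" "f u"] mono[of "f u" "f v"] mono[of "f v" "f u"]
    unfolding far_def by (cases "f u \<le> f v") auto
qed

lemma critical_pair_exists:
  fixes N k d :: int
  assumes G: "pair_wf_digraph G"
    and no: "\<And>k f. k < N \<Longrightarrow> \<not> circular_coloring k 1 G f"
    and "circular_coloring k d G f" "1 \<le> d" "k < N * d"
  obtains k' d' f' where "circular_coloring k' d' G f'" "2 \<le> d'" "k' < N * d'"
    "\<And>g. circular_coloring k' d' G g \<Longrightarrow> {0..<k'} \<subseteq> g ` pverts G"
proof -
  define P where "P m \<longleftrightarrow> (\<exists>k f. 1 \<le> m \<and> circular_coloring k (int m) G f \<and> k < N * int m)" for m
  have "P (nat d)"
    unfolding P_def using assms by auto
  then obtain m where m: "P m" and min: "\<And>j. j < m \<Longrightarrow> \<not> P j"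
    by (metis exists_least_iff)
  obtain k' f' where kf: "1 \<le> m" "circular_coloring k' (int m) G f'" "k' < N * int m"
    using m by (auto simp: P_def)
  have min': "\<not> circular_coloring j e G g" if "1 \<le> e" "e < int m" "j < N * e" for j e g
    using min[of "nat e"] that unfolding P_def by (metis int_nat_eq le_nat_iff nat_less_iff of_nat_1 order_trans zero_le_one)
  have m2: "2 \<le> int m"
    using no[of k' f'] kf by (cases "m = 1") auto
  have cop: "coprime k' (int m)"
  proof (rule ccontr)
    assume "\<not> coprime k' (int m)"
    define g where "g = gcd k' (int m)"
    have "g \<noteq> 1" using \<open>\<not> coprime k' (int m)\<close> by (simp add: g_def coprime_iff_gcd_eq_1)
    moreover have "0 < g" using m2 by (simp add: g_def)
    ultimately have g: "1 < g" by simp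
    obtain k1 d1 where kd1: "k' = g * k1" "int m = g * d1"
      unfolding g_def by (meson dvd_def gcd_dvd1 gcd_dvd2)
    have d1: "1 \<le> d1" using kd1 m2 g by (smt (verit) mult_nonneg_nonpos)
    then have "d1 < int m" using kd1 g by simp
    moreover have "k1 < N * d1" using kf(3) kd1 g by (simp add: mult.left_commute)
    moreover have "circular_coloring k1 d1 G (\<lambda>v. f' v div g)"
      using kf(2) kd1 g by (intro circular_coloring_div) simp_all
    ultimately show False using min' d1 by blast
  qed
  have "{0..<k'} \<subseteq> g ` pverts G" if g: "circular_coloring k' (int m) G g" for g
  proof
    fix p assume p: "p \<in> {0..<k'}"
    show "p \<in> g ` pverts G"
    proof (rule ccontr)
      assume "p \<notin> g ` pverts G"
      then obtain k1 d1 h where h: "1 \<le> d1" "d1 < int m" "k1 * int m < k' * d1" "circular_coloring k1 d1 G h"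
        using unused_color_reduction[OF g G cop m2 p] by metis
      have "k' * d1 < N * int m * d1" using kf(3) h(1) by simp
      with h(3) have "k1 * int m < (N * d1) * int m" by (simp add: algebra_simps)
      then have "k1 < N * d1" using m2 by simp
      then show False using min' h by blast
    qed
  qed
  then show ?thesis using that kf m2 by blast
qed

subsection \<open>Mycielskians\<close>

lemma pverts_mycielskian [simp]:
  "Orig x \<in> pverts (mycielskian G) \<longleftrightarrow> x \<in> pverts G"
  "Twin x \<in> pverts (mycielskian G) \<longleftrightarrow> x \<in> pverts G"
  "Apex \<in> pverts (mycielskian G)"
  by (auto simp: mycielskian_def)

lemma parcs_mycielskian [simp]:
  "(Orig x, Orig y) \<in> parcs (mycielskian G) \<longleftrightarrow> (x, y) \<in> parcs G"
  "(Twin x, Orig y) \<in> parcs (mycielskian G) \<longleftrightarrow> (x, y) \<in> parcs G"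
  "(Orig y, Twin x) \<in> parcs (mycielskian G) \<longleftrightarrow> (x, y) \<in> parcs G"
  "(Twin x, Twin y) \<notin> parcs (mycielskian G)"
  "(Apex, Twin x) \<in> parcs (mycielskian G) \<longleftrightarrow> x \<in> pverts G"
  "(Twin x, Apex) \<in> parcs (mycielskian G) \<longleftrightarrow> x \<in> pverts G"
  "(Apex, Orig x) \<notin> parcs (mycielskian G)"
  "(Orig x, Apex) \<notin> parcs (mycielskian G)"
  "(Apex, Apex) \<notin> parcs (mycielskian G)"
  "(Base b, v) \<notin> parcs (mycielskian G)"
  "(v, Base b) \<notin> parcs (mycielskian G)"
  by (auto simp: mycielskian_def)

lemma pair_graph_mycielskian_funpow:
  "pair_graph G \<Longrightarrow> pair_graph ((mycielskian ^^ t) G)"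
  by (induction t) (simp_all add: pair_graph_mycielskian)

lemma parcs_sym:
  assumes "pair_graph G" "(u, v) \<in> parcs G"
  shows "(v, u) \<in> parcs G"
proof -
  interpret pair_graph G by fact
  show ?thesis
    using pair_sym_arcs assms(2) by (metis symD symmetric_def with_proj_simps(3))
qed

lemma parcs_irrefl:
  assumes "pair_graph G"
  shows "(v, v) \<notin> parcs G"
proof -
  interpret pair_graph G by fact
  show ?thesis
    using pair_no_loops[of "(v, v)"] by auto
qed

lemma parcs_wf:
  assumes "pair_graph G" "(u, v) \<in> parcs G"
  shows "u \<in> pverts G" "v \<in> pverts G"
proof -
  interpret pair_graph G by fact
  show "u \<in> pverts G" "v \<in> pverts G"
    using assms(2) by (auto dest: in_arcsD1 in_arcsD2)
qed

subsection \<open>Chromatic number\<close>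

lemma proper_coloring_iff:
  "proper_coloring m G f \<longleftrightarrow>
     (\<forall>v \<in> pverts G. f v < m) \<and> (\<forall>u v. (u, v) \<in> parcs G \<longrightarrow> f u \<noteq> f v)"
  by (auto simp: proper_coloring_def)

text \<open>Twins share the color of their originals, and \<open>Apex\<close> gets the new color
  \<open>m\<close>.\<close>

lemma proper_coloring_mycielskian:
  assumes "proper_coloring m G f"
  shows "\<exists>g. proper_coloring (Suc m) (mycielskian G) g"
proof
  show "proper_coloring (Suc m) (mycielskian G) (\<lambda>v. case v of Orig x \<Rightarrow> f x | Twin x \<Rightarrow> f x | _ \<Rightarrow> m)"
    using assms unfolding proper_coloring_iff mycielskian_def
    by (auto simp: less_Suc_eq) metis+
qed

text \<open>Originals with the apex color \<open>a\<close> take the color of their twin, which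
  differs from \<open>a\<close>. This frees \<open>a\<close>, and the top color \<open>m\<close> is
  renamed to it.\<close>

lemma proper_coloring_of_mycielskian:
  assumes "pair_graph G" and g: "proper_coloring (Suc m) (mycielskian G) g"
  shows "\<exists>f. proper_coloring m G f"
proof -
  define a where "a = g Apex"
  define h where "h x = (if g (Orig x) = a then g (Twin x) else g (Orig x))" for x
  define f where "f x = (if h x = m then a else h x)" for x
  have rng: "g v < Suc m" if "v \<in> pverts (mycielskian G)" for v
    using g that by (auto simp: proper_coloring_def)
  have neq: "g u \<noteq> g v" if "(u, v) \<in> parcs (mycielskian G)" for u v
    using g that by (auto simp: proper_coloring_def)
  have a: "a \<le> m" using rng[of Apex] by (simp add: a_def)
  have h: "h x \<noteq> a" "h x \<le> m" if "x \<in> pverts G" for x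
    using neq[of Apex "Twin x"] rng[of "Orig x"] rng[of "Twin x"] that by (auto simp: h_def a_def)
  have hh: "h x \<noteq> h y" if xy: "(x, y) \<in> parcs G" for x y
  proof -
    have "(y, x) \<in> parcs G" using parcs_sym[OF assms(1) xy] .
    then show ?thesis
      using xy neq[of "Orig x" "Orig y"] neq[of "Orig x" "Twin y"] neq[of "Twin x" "Orig y"]
      by (auto simp: h_def)
  qed
  have "f x < m" if "x \<in> pverts G" for x
    using h[OF that] a by (auto simp: f_def)
  moreover have "f x \<noteq> f y" if xy: "(x, y) \<in> parcs G" for x y
    using hh[OF xy] h[OF parcs_wf(1)[OF assms(1) xy]] h[OF parcs_wf(2)[OF assms(1) xy]]
    by (auto simp: f_def)
  ultimately have "proper_coloring m G f"
    by (auto simp: proper_coloring_def)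
  then show ?thesis by blast
qed

lemma proper_coloring_mono:
  "proper_coloring m G f \<Longrightarrow> m \<le> m' \<Longrightarrow> proper_coloring m' G f"
  by (auto simp: proper_coloring_iff intro: less_le_trans)

lemma complete_digraphD:
  assumes "K\<^bsub>n\<^esub> (with_proj G)"
  shows "pair_graph G" "finite (pverts G)" "card (pverts G) = n"
    "\<And>u v. (u, v) \<in> parcs G \<longleftrightarrow> u \<in> pverts G \<and> v \<in> pverts G \<and> u \<noteq> v"
proof -
  show "finite (pverts G)" "card (pverts G) = n"
    "\<And>u v. (u, v) \<in> parcs G \<longleftrightarrow> u \<in> pverts G \<and> v \<in> pverts G \<and> u \<noteq> v"
    using assms by (auto simp: complete_digraph_pair_def)
  show "pair_graph G"
    using assms by (rule pair_graphI_complete)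
qed

lemma proper_coloring_complete_iff:
  assumes "K\<^bsub>n\<^esub> (with_proj G)"
  shows "(\<exists>f. proper_coloring m G f) \<longleftrightarrow> n \<le> m"
proof
  note K = complete_digraphD[OF assms]
  assume "\<exists>f. proper_coloring m G f"
  then obtain f where f: "proper_coloring m G f" by blast
  then have "inj_on f (pverts G)" "f ` pverts G \<subseteq> {..<m}"
    using K(4) by (auto simp: proper_coloring_iff inj_on_def)
  then have "card (pverts G) \<le> card {..<m}"
    by (intro card_inj_on_le) auto
  then show "n \<le> m" using K(3) by simp
next
  note K = complete_digraphD[OF assms]
  assume "n \<le> m"
  obtain f where f: "bij_betw f (pverts G) {0..<n}"
    using ex_bij_betw_finite_nat[OF K(2)] K(3) by auto
  have "proper_coloring n G f"
    using bij_betwE[OF f] bij_betw_imp_inj_on[OF f] K(4)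
    by (fastforce simp: proper_coloring_iff inj_on_def)
  then show "\<exists>f. proper_coloring m G f"
    using proper_coloring_mono \<open>n \<le> m\<close> by blast
qed

lemma proper_coloring_iterated_iff:
  assumes "K\<^bsub>n\<^esub> (with_proj G)"
  shows "(\<exists>f. proper_coloring m ((mycielskian ^^ t) G) f) \<longleftrightarrow> n + t \<le> m"
proof (induction t arbitrary: m)
  case 0
  then show ?case using proper_coloring_complete_iff[OF assms] by simp
next
  case (Suc t)
  have G: "pair_graph ((mycielskian ^^ t) G)"
    using complete_digraphD(1)[OF assms] by (rule pair_graph_mycielskian_funpow)
  show ?case
  proof
    assume "\<exists>f. proper_coloring m ((mycielskian ^^ Suc t) G) f"
    then obtain f where f: "proper_coloring m (mycielskian ((mycielskian ^^ t) G)) f" by auto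
    then have "f Apex < m" by (auto simp: proper_coloring_iff)
    then obtain m' where m': "m = Suc m'" by (cases m) auto
    then show "n + Suc t \<le> m"
      using proper_coloring_of_mycielskian[OF G] f Suc.IH[of m'] by auto
  next
    assume *: "n + Suc t \<le> m"
    then obtain f where "proper_coloring (m - 1) ((mycielskian ^^ t) G) f"
      using Suc.IH[of "m - 1"] by auto
    then show "\<exists>f. proper_coloring m ((mycielskian ^^ Suc t) G) f"
      using proper_coloring_mycielskian[of "m - 1"] * by auto
  qed
qed

lemma chromatic_number_iterated:
  assumes "K\<^bsub>n\<^esub> (with_proj G)"
  shows "chromatic_number ((mycielskian ^^ t) G) = n + t"
  unfolding chromatic_number_def proper_coloring_iterated_iff[OF assms]
  by (rule Least_equality) auto

text \<open>On \<open>{0..<k}\<close> the relation \<open>far k 1\<close> is just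
  inequality.\<close>

lemma circular_coloring_of_proper_coloring:
  assumes G: "pair_graph G" and f: "proper_coloring m G f"
  shows "circular_coloring (int m) 1 G (int \<circ> f)"
  unfolding circular_coloring_iff
proof (intro conjI ballI allI impI)
  fix v assume "v \<in> pverts G"
  then show "(int \<circ> f) v \<in> {0..<int m}" using f by (simp add: proper_coloring_iff)
next
  fix u v assume uv: "(u, v) \<in> parcs G"
  then have "f u < m" "f v < m" "f u \<noteq> f v"
    using f parcs_wf[OF G uv] by (simp_all add: proper_coloring_iff)
  then show "far (int m) 1 ((int \<circ> f) u) ((int \<circ> f) v)"
    by (auto simp: far_def)
qed

lemma proper_coloring_of_circular_coloring:
  assumes G: "pair_graph G" and f: "circular_coloring k 1 G f"
  shows "proper_coloring (nat k) G (nat \<circ> f)"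
  unfolding proper_coloring_iff
proof (intro conjI ballI allI impI)
  fix v assume "v \<in> pverts G"
  then show "(nat \<circ> f) v < nat k" using f by (auto simp: circular_coloring_iff)
next
  fix u v assume uv: "(u, v) \<in> parcs G"
  then have "0 \<le> f u" "0 \<le> f v" "far k 1 (f u) (f v)"
    using f parcs_wf[OF G uv] by (simp_all add: circular_coloring_iff)
  then have "0 \<le> f u" "0 \<le> f v" "f u \<noteq> f v"
    by (auto simp: far_def)
  then show "(nat \<circ> f) u \<noteq> (nat \<circ> f) v" by simp
qed

subsection \<open>Vertices of iterated Mycielskians\<close>

text \<open>The descendants of \<open>x\<close>, with one choice between original and twin per step;
  \<open>apexes t\<close> below collects the descendants of the apexes of all \<open>t\<close>
  steps.\<close>

fun copies :: "nat \<Rightarrow> 'a vert \<Rightarrow> 'a vert set" where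
  "copies 0 x = {x}"
| "copies (Suc t) x = Orig ` copies t x \<union> Twin ` copies t x"

fun apexes :: "nat \<Rightarrow> 'a vert set" where
  "apexes 0 = {}"
| "apexes (Suc t) = insert Apex (Orig ` apexes t \<union> Twin ` apexes t)"

lemma pverts_iterated:
  "pverts ((mycielskian ^^ t) G) = apexes t \<union> (\<Union>x \<in> pverts G. copies t x)"
proof (induction t)
  case (Suc t)
  have "pverts ((mycielskian ^^ Suc t) G) =
      insert Apex (Orig ` pverts ((mycielskian ^^ t) G) \<union> Twin ` pverts ((mycielskian ^^ t) G))"
    by (simp add: mycielskian_def)
  also have "\<dots> = apexes (Suc t) \<union> (\<Union>x \<in> pverts G. copies (Suc t) x)"
    unfolding Suc.IH by auto
  finally show ?case .
qed simp

lemma apexes_subset: "apexes t \<subseteq> pverts ((mycielskian ^^ t) G)"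
  by (simp add: pverts_iterated)

lemma card_apexes: "finite (apexes t :: 'a vert set) \<and> card (apexes t :: 'a vert set) = 2 ^ t - 1"
proof (induction t)
  case (Suc t)
  let ?A = "apexes t :: 'a vert set"
  have ar: "Suc ((p - 1) + (p - 1)) = 2 * p - 1" if "1 \<le> p" for p :: nat
    using that by arith
  have "card (Orig ` ?A \<union> Twin ` ?A) = card (Orig ` ?A) + card (Twin ` ?A)"
    using Suc by (intro card_Un_disjoint) auto
  also have "\<dots> = card ?A + card ?A"
    by (simp add: card_image inj_on_def)
  finally have "card (Orig ` ?A \<union> Twin ` ?A) = (2 ^ t - 1) + (2 ^ t - 1)"
    using Suc by simp
  moreover have "Apex \<notin> Orig ` ?A \<union> Twin ` ?A" by auto
  ultimately have "card (insert Apex (Orig ` ?A \<union> Twin ` ?A)) = Suc ((2 ^ t - 1) + (2 ^ t - 1))"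
    using Suc by (subst card_insert_disjoint) simp_all
  also have "\<dots> = 2 ^ Suc t - 1"
    using ar[of "2 ^ t"] by simp
  finally have "card (insert Apex (Orig ` ?A \<union> Twin ` ?A)) = 2 ^ Suc t - 1" .
  then show ?case
    using Suc by simp
qed simp

lemma funpow_Orig_in_copies: "(Orig ^^ t) x \<in> copies t x"
  by (induction t) auto

lemma funpow_Orig_in_pverts: "x \<in> pverts G \<Longrightarrow> (Orig ^^ t) x \<in> pverts ((mycielskian ^^ t) G)"
  using funpow_Orig_in_copies[of t x] by (auto simp: pverts_iterated)

text \<open>If \<open>v\<close> is adjacent to \<open>w\<close>, then both \<open>Orig v\<close> and
  \<open>Twin v\<close> are adjacent to \<open>Orig w\<close>; so adjacency to the pure original of
  \<open>y\<close> survives every step.\<close>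

lemma copies_adjacent_Orig:
  assumes "(x, y) \<in> parcs G" "v \<in> copies t x"
  shows "(v, (Orig ^^ t) y) \<in> parcs ((mycielskian ^^ t) G)"
  using assms(2) by (induction t arbitrary: v) (use assms(1) in auto)

text \<open>A new apex is adjacent to the twin of each earlier vertex. A neighbor \<open>v\<close>
  of \<open>u\<close> persists as \<open>Orig v\<close>, adjacent to both \<open>Orig u\<close> and
  \<open>Twin u\<close>.\<close>

lemma apexes_adjacent_copies:
  assumes "u \<in> apexes t" "x \<in> pverts G"
  obtains v where "v \<in> copies t x" "(u, v) \<in> parcs ((mycielskian ^^ t) G)"
proof -
  have "\<exists>v \<in> copies t x. (u, v) \<in> parcs ((mycielskian ^^ t) G)"
    using assms(1)
  proof (induction t arbitrary: u)
    case (Suc t)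
    then consider "u = Apex" | u' where "u = Orig u'" "u' \<in> apexes t" | u' where "u = Twin u'" "u' \<in> apexes t"
      by auto
    then show ?case
    proof cases
      case 1
      then show ?thesis
        using funpow_Orig_in_copies[of t x] funpow_Orig_in_pverts[OF assms(2), of t]
        by (intro bexI[of _ "Twin ((Orig ^^ t) x)"]) auto
    next
      case (2 u')
      then show ?thesis
        using Suc.IH[of u'] by (auto intro!: bexI[of _ "Orig _"])
    next
      case (3 u')
      then show ?thesis
        using Suc.IH[of u'] by (auto intro!: bexI[of _ "Orig _"])
    qed
  qed simp
  then show ?thesis using that by blast
qed

subsection \<open>Counting colors near a separated set\<close>

text \<open>The colors of a clique form such a set.\<close>

definition separated :: "int \<Rightarrow> int \<Rightarrow> int set \<Rightarrow> bool" where
  "separated k d S \<longleftrightarrow> S \<subseteq> {0..<k} \<and> (\<forall>a \<in> S. \<forall>b \<in> S. a \<noteq> b \<longrightarrow> far k d a b)"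

text \<open>Adding \<open>d - 1\<close> shifts the window of close differences, from
  \<open>-(d - 1)\<close> to \<open>d - 1\<close>, so that it starts at 0; closeness becomes one
  inequality on a residue.\<close>

lemma not_far_iff_mod:
  fixes k d a b :: int
  assumes "a \<in> {0..<k}" "b \<in> {0..<k}" "1 \<le> d" "2 * d \<le> k"
  shows "\<not> far k d a b \<longleftrightarrow> (a - b + d - 1) mod k < 2 * d - 1"
proof -
  define x where "x = a - b + d - 1"
  consider "x < 0" | "0 \<le> x" "x < k" | "k \<le> x" by linarith
  then show ?thesis
  proof cases
    case 1
    then have "x mod k = x + k"
      using assms by (subst mod_add_self2[symmetric], intro mod_pos_pos_trivial) (auto simp: x_def)
    then show ?thesis using 1 assms unfolding x_def[symmetric] by (auto simp: far_def x_def)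
  next
    case 2
    then have "x mod k = x" by simp
    then show ?thesis using 2 assms unfolding x_def[symmetric] by (auto simp: far_def x_def)
  next
    case 3
    then have "(x - k) mod k = x - k"
      using assms by (intro mod_pos_pos_trivial) (auto simp: x_def)
    then have "x mod k = x - k" by simp
    then show ?thesis using 3 assms unfolding x_def[symmetric] by (auto simp: far_def x_def)
  qed
qed

text \<open>The rotation \<open>\<phi>\<close>, inverted by \<open>\<psi>\<close>, carries the
  colors close to \<open>c\<close> onto the first \<open>2 * d - 1\<close> residues.\<close>

lemma card_near:
  fixes k d c :: int
  assumes c: "c \<in> {0..<k}" and d: "1 \<le> d" "2 * d \<le> k"
  shows "int (card {q \<in> {0..<k}. \<not> far k d q c}) = 2 * d - 1"
proof -
  define \<phi> \<psi> where "\<phi> q = (q - c + d - 1) mod k" and "\<psi> x = (x + c - d + 1) mod k" for q x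
  have k: "0 < k" using d by simp
  have inv: "\<psi> (\<phi> q) = q mod k" "\<phi> (\<psi> x) = x mod k" for q x
  proof -
    have "\<psi> (\<phi> q) = (\<phi> q + (c - d + 1)) mod k" "\<phi> (\<psi> x) = (\<psi> x + (- c + d - 1)) mod k"
      unfolding \<psi>_def[of "\<phi> q"] \<phi>_def[of "\<psi> x"] by (simp_all add: algebra_simps)
    then show "\<psi> (\<phi> q) = q mod k" "\<phi> (\<psi> x) = x mod k"
      by (simp_all add: \<psi>_def \<phi>_def mod_add_left_eq)
  qed
  have "bij_betw \<phi> {q \<in> {0..<k}. \<not> far k d q c} {0..<2 * d - 1}"
  proof (rule bij_betw_byWitness[where f' = \<psi>])
    show "\<forall>q \<in> {q \<in> {0..<k}. \<not> far k d q c}. \<psi> (\<phi> q) = q"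
      by (simp add: inv)
    show "\<forall>x \<in> {0..<2 * d - 1}. \<phi> (\<psi> x) = x"
      using d by (simp add: inv)
    show "\<phi> ` {q \<in> {0..<k}. \<not> far k d q c} \<subseteq> {0..<2 * d - 1}"
      using not_far_iff_mod[OF _ c d] k by (auto simp: \<phi>_def)
    show "\<psi> ` {0..<2 * d - 1} \<subseteq> {q \<in> {0..<k}. \<not> far k d q c}"
    proof safe
      fix x assume x: "x \<in> {0..<2 * d - 1}"
      show r: "\<psi> x \<in> {0..<k}" using k by (simp add: \<psi>_def)
      have "(\<psi> x - c + d - 1) mod k = x"
        using x d inv(2)[of x] by (simp add: \<phi>_def)
      moreover assume "far k d (\<psi> x) c"
      ultimately show False using not_far_iff_mod[OF r c d] x by simp
    qed
  qed
  then show ?thesis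
    using bij_betw_same_card d by fastforce
qed

text \<open>The offsets \<open>r s\<close> of close colors lie between 0 and
  \<open>2 * d - 2\<close>, while those of separated colors differ by at least \<open>d\<close>;
  three of them do not fit.\<close>

lemma separated_near_card:
  fixes k d q :: int
  assumes S: "separated k d S" and q: "q \<in> {0..<k}" and d: "1 \<le> d" "2 * d \<le> k"
  shows "card {s \<in> S. \<not> far k d q s} \<le> 2"
proof (rule ccontr)
  assume "\<not> ?thesis"
  then have "3 \<le> card {s \<in> S. \<not> far k d q s}" by simp
  then obtain T where T: "T \<subseteq> {s \<in> S. \<not> far k d q s}" "card T = 3"
    by (meson obtain_subset_with_card_n)
  then obtain x y z where xyz: "x \<in> T" "y \<in> T" "z \<in> T" "x \<noteq> y" "y \<noteq> z" "x \<noteq> z"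
    by (auto simp: card_3_iff)
  define r where "r s = (q - s + d - 1) mod k" for s
  have r: "0 \<le> r s" "r s < 2 * d - 1" if "s \<in> T" for s
  proof -
    have s: "s \<in> {0..<k}" "\<not> far k d q s"
      using that T S by (auto simp: separated_def)
    then show "0 \<le> r s" "r s < 2 * d - 1"
      using not_far_iff_mod[OF q s(1) d] d by (simp_all add: r_def)
  qed
  have "d \<le> \<bar>r s - r s'\<bar>" if ss: "s \<in> T" "s' \<in> T" "s \<noteq> s'" for s s'
  proof (rule ccontr)
    assume "\<not> ?thesis"
    then have "0 \<le> r s - r s' + d - 1" "r s - r s' + d - 1 < 2 * d - 1" by auto
    moreover from this have "(r s - r s' + d - 1) mod k = r s - r s' + d - 1"
      using d by (intro mod_pos_pos_trivial) auto
    moreover have "(r s - r s' + d - 1) mod k = (s' - s + d - 1) mod k"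
    proof -
      have "(r s - r s') mod k = (s' - s) mod k"
        unfolding r_def mod_diff_eq by simp
      then have "((r s - r s') mod k + (d - 1)) mod k = ((s' - s) mod k + (d - 1)) mod k"
        by simp
      then show ?thesis
        unfolding mod_add_left_eq by (simp only: add_diff_eq)
    qed
    moreover have "s \<in> S" "s' \<in> S"
      using ss T by auto
    then have "s' \<in> {0..<k}" "s \<in> {0..<k}" "far k d s' s"
      using ss(3) S unfolding separated_def by (blast, blast, metis)
    ultimately show False
      using not_far_iff_mod[of s' k s d] d by simp
  qed
  then have "d \<le> \<bar>r x - r y\<bar>" "d \<le> \<bar>r y - r z\<bar>" "d \<le> \<bar>r x - r z\<bar>"
    using xyz by auto
  then show False
    using r[OF xyz(1)] r[OF xyz(2)] r[OF xyz(3)] by linarith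
qed

definition near_two :: "int \<Rightarrow> int \<Rightarrow> int set \<Rightarrow> int set" where
  "near_two k d S = {q \<in> {0..<k}. \<exists>a \<in> S. \<exists>b \<in> S. a \<noteq> b \<and> \<not> far k d q a \<and> \<not> far k d q b}"

definition far_all :: "int \<Rightarrow> int \<Rightarrow> int set \<Rightarrow> int set" where
  "far_all k d S = {q \<in> {0..<k}. \<forall>a \<in> S. far k d q a}"

text \<open>Double counting of close pairs: each element of \<open>S\<close> is close to
  \<open>2 * d - 1\<close> colors, and each color to at most two elements of \<open>S\<close>, to
  two only in \<open>near_two\<close> and to none exactly in \<open>far_all\<close>.\<close>

lemma card_near_two:
  assumes S: "separated k d S" and d: "1 \<le> d" "2 * d \<le> k"
  shows "int (card S) * (2 * d - 1) + int (card (far_all k d S)) \<le> k + int (card (near_two k d S))"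
proof -
  have SS: "S \<subseteq> {0..<k}" using S by (simp add: separated_def)
  have fin: "finite S" using SS finite_subset by blast
  define N where "N q = card {s \<in> S. \<not> far k d q s}" for q
  have pt: "int (N q) + (if q \<in> far_all k d S then 1 else 0) \<le> 1 + (if q \<in> near_two k d S then 1 else 0)"
    if q: "q \<in> {0..<k}" for q
  proof -
    have N2: "N q \<le> 2" using separated_near_card[OF S q d] by (simp add: N_def)
    have f: "N q = 0" if "q \<in> far_all k d S"
    proof -
      have "{s \<in> S. \<not> far k d q s} = {}" using that by (auto simp: far_all_def)
      then show ?thesis unfolding N_def by (simp only: card.empty)
    qed
    have t: "q \<in> near_two k d S" if "1 < N q"
    proof -
      have "\<exists>a b. a \<in> {s \<in> S. \<not> far k d q s} \<and> b \<in> {s \<in> S. \<not> far k d q s} \<and> a \<noteq> b"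
        using that unfolding N_def using card_1_singleton_iff
        by (metis (no_types, lifting) One_nat_def card_le_Suc0_iff_eq card_gt_0_iff gr_implies_not_zero not_le not_gr_zero less_le_trans)
      then show ?thesis using q by (auto simp: near_two_def)
    qed
    show ?thesis using N2 f t by (cases "1 < N q") auto
  qed
  have "int (card S) * (2 * d - 1) = (\<Sum>s \<in> S. int (card {q \<in> {0..<k}. \<not> far k d q s}))"
    using card_near[OF _ d] SS by (simp add: subset_iff)
  also have "\<dots> = (\<Sum>s \<in> S. \<Sum>q \<in> {0..<k}. if \<not> far k d q s then 1 else 0)"
    by (simp add: sum.If_cases Int_def)
  also have "\<dots> = (\<Sum>q \<in> {0..<k}. \<Sum>s \<in> S. if \<not> far k d q s then 1 else 0)"
    by (rule sum.swap)
  also have "\<dots> = (\<Sum>q \<in> {0..<k}. int (N q))"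
    using fin by (simp add: sum.If_cases Int_def N_def)
  finally have 1: "int (card S) * (2 * d - 1) = (\<Sum>q \<in> {0..<k}. int (N q))" .
  have sub: "far_all k d S \<subseteq> {0..<k}" "near_two k d S \<subseteq> {0..<k}"
    by (auto simp: far_all_def near_two_def)
  have ind: "(\<Sum>q \<in> {0..<k}. if q \<in> A then 1 else 0) = int (card A)" if "A \<subseteq> {0..<k}" for A
    using that by (simp add: sum.If_cases Int_absorb1)
  have "(\<Sum>q \<in> {0..<k}. int (N q) + (if q \<in> far_all k d S then 1 else 0))
      \<le> (\<Sum>q \<in> {0..<k}. 1 + (if q \<in> near_two k d S then 1 else 0))"
    by (intro sum_mono pt)
  then show ?thesis
    using 1 ind[OF sub(1)] ind[OF sub(2)] d by (simp add: sum.distrib)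
qed

section \<open>Distance 2: successors and predecessors on the color cycle\<close>

definition nxt :: "int \<Rightarrow> int \<Rightarrow> int" where
  "nxt k q = (if q = k - 1 then 0 else q + 1)"

definition prv :: "int \<Rightarrow> int \<Rightarrow> int" where
  "prv k q = (if q = 0 then k - 1 else q - 1)"

lemma nxt_prv_range:
  assumes "q \<in> {0..<k}"
  shows "nxt k q \<in> {0..<k}" "prv k q \<in> {0..<k}" "nxt k (prv k q) = q" "prv k (nxt k q) = q"
  using assms by (auto simp: nxt_def prv_def)

lemma not_far_2_iff:
  assumes "a \<in> {0..<k}" "b \<in> {0..<k}" "4 < k"
  shows "\<not> far k 2 a b \<longleftrightarrow> b = a \<or> b = nxt k a \<or> b = prv k a"
  using assms by (auto simp: far_def nxt_def prv_def)

lemma nxt_neq_prv: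
  assumes "q \<in> {0..<k}" "4 < k"
  shows "nxt k q \<noteq> prv k q" "nxt k q \<noteq> q" "prv k q \<noteq> q" "far k 2 (nxt k q) (prv k q)"
  using assms by (auto simp: far_def nxt_def prv_def)

text \<open>The colors close to \<open>q\<close> are \<open>q\<close> and its two cyclic neighbors.
  As \<open>q\<close> is close to both neighbors, the two elements of \<open>S\<close> must be the
  neighbors.\<close>

lemma near_two_2:
  assumes S: "separated k 2 S" and k: "4 < k" and q: "q \<in> near_two k 2 S"
  shows "nxt k q \<in> S" "prv k q \<in> S"
proof -
  obtain a b where ab: "a \<in> S" "b \<in> S" "a \<noteq> b" "\<not> far k 2 q a" "\<not> far k 2 q b" and q': "q \<in> {0..<k}"
    using q by (auto simp: near_two_def)
  have r: "a \<in> {0..<k}" "b \<in> {0..<k}" "far k 2 a b"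
    using ab S by (auto simp: separated_def)
  have "a = q \<or> a = nxt k q \<or> a = prv k q" "b = q \<or> b = nxt k q \<or> b = prv k q"
    using ab r q' k not_far_2_iff by blast+
  moreover have "\<not> far k 2 q (nxt k q)" "\<not> far k 2 q (prv k q)" "\<not> far k 2 (nxt k q) q" "\<not> far k 2 (prv k q) q"
    using not_far_2_iff[OF q' nxt_prv_range(1)[OF q'] k] not_far_2_iff[OF q' nxt_prv_range(2)[OF q'] k]
    by (auto simp: far_commute)
  ultimately show "nxt k q \<in> S" "prv k q \<in> S"
    using ab r by auto
qed

text \<open>If two such colors \<open>q\<close> and \<open>q'\<close> were consecutive, then
  \<open>q'\<close>, as a neighbor of \<open>q\<close>, and \<open>nxt k q'\<close> would both lie
  in \<open>S\<close>, although they are close.\<close>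

lemma separated_near_two:
  assumes S: "separated k 2 S" and k: "4 < k"
  shows "separated k 2 (near_two k 2 S)"
  unfolding separated_def
proof (intro conjI ballI impI)
  show "near_two k 2 S \<subseteq> {0..<k}" by (auto simp: near_two_def)
  fix q q' assume q: "q \<in> near_two k 2 S" and q': "q' \<in> near_two k 2 S" and "q \<noteq> q'"
  have r: "q \<in> {0..<k}" "q' \<in> {0..<k}" using q q' by (auto simp: near_two_def)
  note N = near_two_2[OF S k q] near_two_2[OF S k q']
  show "far k 2 q q'"
  proof (rule ccontr)
    assume "\<not> far k 2 q q'"
    then have "q' = nxt k q \<or> q' = prv k q"
      using not_far_2_iff[OF r k] \<open>q \<noteq> q'\<close> by auto
    then have "q' \<in> S" using N by auto
    then have "far k 2 q' (nxt k q')"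
      using N(3) S nxt_neq_prv[OF r(2) k] by (auto simp: separated_def)
    then show False
      using not_far_2_iff[OF r(2) nxt_prv_range(1)[OF r(2)] k] by simp
  qed
qed

section \<open>Recoloring vertices; counting when every color is close to a separated one\<close>

lemma circular_coloring_update:
  assumes G: "pair_graph G" and f: "circular_coloring k d G f" and c: "c \<in> {0..<k}"
    and w: "\<And>w. (v, w) \<in> parcs G \<Longrightarrow> far k d c (f w)"
  shows "circular_coloring k d G (f(v := c))"
  unfolding circular_coloring_iff
proof (intro conjI ballI allI impI)
  show "(f(v := c)) x \<in> {0..<k}" if "x \<in> pverts G" for x
    using f c that by (simp add: circular_coloring_iff)
next
  fix x y assume xy: "(x, y) \<in> parcs G"
  have "x \<noteq> y" using parcs_irrefl[OF G] xy by auto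
  moreover have "far k d (f x) (f y)" using f xy by (simp add: circular_coloring_iff)
  moreover have "far k d (f x) c" if "y = v"
    using w[of x] parcs_sym[OF G xy] that by (simp add: far_commute)
  ultimately show "far k d ((f(v := c)) x) ((f(v := c)) y)"
    using w[of y] xy by auto
qed

text \<open>Apart from \<open>Apex\<close>, every neighbor of \<open>Twin x\<close> is also a
  neighbor of \<open>Orig x\<close>, and twins are pairwise nonadjacent. So all twins whose original
  is far from \<open>Apex\<close> may take its color at once.\<close>

lemma circular_coloring_mycielskian_normalize:
  assumes G: "pair_graph G" and f: "circular_coloring k d (mycielskian G) f"
  obtains g where "circular_coloring k d (mycielskian G) g"
    "\<And>x. g (Twin x) = g (Orig x) \<or> \<not> far k d (g (Orig x)) (g Apex)"
proof -
  define g where "g v = (case v of Twin x \<Rightarrow> if far k d (f (Orig x)) (f Apex) then f (Orig x) else f (Twin x)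
      | _ \<Rightarrow> f v)" for v
  have g: "g (Orig x) = f (Orig x)" "g Apex = f Apex"
    "g (Twin x) = (if far k d (f (Orig x)) (f Apex) then f (Orig x) else f (Twin x))" for x
    by (simp_all add: g_def)
  have rng: "f v \<in> {0..<k}" if "v \<in> pverts (mycielskian G)" for v
    using f that by (simp add: circular_coloring_iff)
  have far: "far k d (f u) (f v)" if "(u, v) \<in> parcs (mycielskian G)" for u v
    using f that by (simp add: circular_coloring_iff)
  have F: "far k d (f (Orig x)) (f (Orig y)) \<and> far k d (f (Orig y)) (f (Orig x)) \<and>
      far k d (f (Twin x)) (f (Orig y)) \<and> far k d (f (Orig y)) (f (Twin x))"
    if "(x, y) \<in> parcs G" for x y
    using that far[of "Orig x" "Orig y"] far[of "Twin x" "Orig y"]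
    by (simp add: far_commute[of k d "f (Orig y)"])
  have A: "far k d (f Apex) (f (Twin x)) \<and> far k d (f (Twin x)) (f Apex)" if "x \<in> pverts G" for x
    using that far[of Apex "Twin x"] far[of "Twin x" Apex] by simp
  have "circular_coloring k d (mycielskian G) g"
    unfolding circular_coloring_iff
  proof (intro conjI ballI allI impI)
    fix v assume "v \<in> pverts (mycielskian G)"
    then show "g v \<in> {0..<k}"
      by (cases v) (use rng in \<open>auto simp: mycielskian_def g\<close>)
  next
    fix u v assume uv: "(u, v) \<in> parcs (mycielskian G)"
    then show "far k d (g u) (g v)"
      by (cases u; cases v) (use F A in \<open>simp_all add: g far_commute[of k d "f Apex" "f (Orig _)"]\<close>)
  qed
  then show ?thesis
    using that g by metis
qed

text \<open>The color \<open>e\<close> from \<open>X\<close> is close to some element of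
  \<open>S\<close>, hence to \<open>prv k q\<close> alone. Being far from \<open>q\<close>, it must
  be \<open>prv k (prv k q)\<close>. Symmetrically, \<open>Y\<close> yields
  \<open>nxt k (nxt k q)\<close>, so each \<open>q\<close> accounts for three colors outside
  \<open>S\<close>.\<close>

lemma card_near_two_if_no_far:
  assumes S: "separated k 2 S" and k: "4 < k" and none: "far_all k 2 S = {}"
    and X: "\<And>q. q \<in> near_two k 2 S \<Longrightarrow>
        \<exists>e \<in> {0..<k}. far k 2 e q \<and> (\<forall>s \<in> S. s \<noteq> prv k q \<longrightarrow> far k 2 e s)"
    and Y: "\<And>q. q \<in> near_two k 2 S \<Longrightarrow>
        \<exists>e \<in> {0..<k}. far k 2 e q \<and> (\<forall>s \<in> S. s \<noteq> nxt k q \<longrightarrow> far k 2 e s)"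
  shows "int (card S) + 3 * int (card (near_two k 2 S)) \<le> k"
proof -
  define Z N where "Z = near_two k 2 S" and "N e = {s \<in> S. \<not> far k 2 e s}" for e
  have Zr: "Z \<subseteq> {0..<k}" and Sr: "S \<subseteq> {0..<k}"
    using S by (auto simp: Z_def near_two_def separated_def)
  have nf: "\<not> far k 2 q (nxt k q)" "\<not> far k 2 q (prv k q)" "\<not> far k 2 q q" if "q \<in> {0..<k}" for q
    using not_far_2_iff[OF that nxt_prv_range(1)[OF that] k] not_far_2_iff[OF that nxt_prv_range(2)[OF that] k]
      not_far_2_iff[OF that that k] by auto
  have NZ: "{nxt k q, prv k q} \<subseteq> N q" if "q \<in> Z" for q
    using that Zr near_two_2[OF S k, of q] nf[of q] by (auto simp: N_def Z_def)
  have NS: "N s = {s}" if "s \<in> S" for s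
    using that S Sr nf[of s] by (auto simp: N_def separated_def)
  have NP: "N (prv k (prv k q)) = {nxt k (prv k (prv k q))} \<and> prv k (prv k q) \<in> {0..<k}" if q: "q \<in> Z" for q
  proof -
    have qr: "q \<in> {0..<k}" using q Zr by auto
    obtain e where e: "e \<in> {0..<k}" "far k 2 e q" and eS: "\<forall>s \<in> S. s \<noteq> prv k q \<longrightarrow> far k 2 e s"
      using X[of q] q unfolding Z_def by auto
    obtain s where s: "s \<in> S" "\<not> far k 2 e s" using none e(1) by (auto simp: far_all_def)
    with eS have sq: "s = prv k q" by auto
    have pr: "prv k q \<in> {0..<k}" "nxt k (prv k q) = q" using nxt_prv_range[OF qr] by auto
    have "e = prv k q \<or> e = nxt k (prv k q) \<or> e = prv k (prv k q)"
      using s sq not_far_2_iff[OF pr(1) e(1) k] by (auto simp: far_commute)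
    moreover have "e \<noteq> q" using e(2) nf(3)[OF qr] by metis
    moreover have "e \<noteq> prv k q" using e(2) nf(1,2)[OF qr] by (metis far_commute)
    ultimately have eq: "e = prv k (prv k q)" using pr(2) by auto
    have "N e = {prv k q}" using s sq eS by (auto simp: N_def)
    moreover have "nxt k e = prv k q" using eq nxt_prv_range[OF pr(1)] by simp
    ultimately show ?thesis using e(1) eq by simp
  qed
  have NN: "N (nxt k (nxt k q)) = {prv k (nxt k (nxt k q))} \<and> nxt k (nxt k q) \<in> {0..<k}" if q: "q \<in> Z" for q
  proof -
    have qr: "q \<in> {0..<k}" using q Zr by auto
    obtain e where e: "e \<in> {0..<k}" "far k 2 e q" and eS: "\<forall>s \<in> S. s \<noteq> nxt k q \<longrightarrow> far k 2 e s"
      using Y[of q] q unfolding Z_def by auto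
    obtain s where s: "s \<in> S" "\<not> far k 2 e s" using none e(1) by (auto simp: far_all_def)
    with eS have sq: "s = nxt k q" by auto
    have pr: "nxt k q \<in> {0..<k}" "prv k (nxt k q) = q" using nxt_prv_range[OF qr] by auto
    have "e = nxt k q \<or> e = prv k (nxt k q) \<or> e = nxt k (nxt k q)"
      using s sq not_far_2_iff[OF pr(1) e(1) k] by (auto simp: far_commute)
    moreover have "e \<noteq> q" using e(2) nf(3)[OF qr] by metis
    moreover have "e \<noteq> nxt k q" using e(2) nf(1,2)[OF qr] by (metis far_commute)
    ultimately have eq: "e = nxt k (nxt k q)" using pr(2) by auto
    have "N e = {nxt k q}" using s sq eS by (auto simp: N_def)
    moreover have "prv k e = nxt k q" using eq nxt_prv_range[OF pr(1)] by simp
    ultimately show ?thesis using e(1) eq by simp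
  qed
  define P Q where "P = (\<lambda>q. prv k (prv k q)) ` Z" and "Q = (\<lambda>q. nxt k (nxt k q)) ` Z"
  have inj: "inj_on (\<lambda>q. prv k (prv k q)) Z" "inj_on (\<lambda>q. nxt k (nxt k q)) Z"
  proof -
    have "nxt k (nxt k (prv k (prv k q))) = q" "prv k (prv k (nxt k (nxt k q))) = q" if "q \<in> Z" for q
      using nxt_prv_range[of q k] nxt_prv_range[of "prv k q" k] nxt_prv_range[of "nxt k q" k] that Zr
      by (simp_all add: subset_iff)
    then show "inj_on (\<lambda>q. prv k (prv k q)) Z" "inj_on (\<lambda>q. nxt k (nxt k q)) Z"
      by (auto intro: inj_on_inverseI[where g = "\<lambda>q. nxt k (nxt k q)"] inj_on_inverseI[where g = "\<lambda>q. prv k (prv k q)"])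
  qed
  have fin: "finite Z" "finite S" using finite_subset[OF Zr] finite_subset[OF Sr] by simp_all
  have NPQ: "e \<in> {0..<k} \<and> N e = {nxt k e}" if "e \<in> P" for e
    using that NP by (auto simp: P_def)
  have NQ: "e \<in> {0..<k} \<and> N e = {prv k e}" if "e \<in> Q" for e
    using that NN by (auto simp: Q_def)
  have neq: "nxt k e \<noteq> prv k e" "nxt k e \<noteq> e" "prv k e \<noteq> e" if "e \<in> {0..<k}" for e
    using nxt_neq_prv[OF that k] by simp_all
  \<comment> \<open>\<open>N e\<close> tells the four sets apart: it contains both cyclic neighbors
    of \<open>e\<close> on \<open>Z\<close>, and is \<open>{e}\<close> on \<open>S\<close>, only the
    successor on \<open>P\<close>, only the predecessor on \<open>Q\<close>.\<close>
  have ZS: "Z \<inter> S = {}"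
  proof safe
    fix e assume "e \<in> Z" "e \<in> S"
    then show "e \<in> {}" using NZ[of e] NS[of e] neq[of e] Zr by auto
  qed
  have ZSP: "(Z \<union> S) \<inter> P = {}"
  proof safe
    fix e assume P: "e \<in> P"
    show "e \<in> {}" if "e \<in> Z" using NZ[OF that] NPQ[OF P] neq[of e] by auto
    show "e \<in> {}" if "e \<in> S" using NS[OF that] NPQ[OF P] neq[of e] by auto
  qed
  have ZSPQ: "(Z \<union> S \<union> P) \<inter> Q = {}"
  proof safe
    fix e assume Q: "e \<in> Q"
    show "e \<in> {}" if "e \<in> Z" using NZ[OF that] NQ[OF Q] neq[of e] by auto
    show "e \<in> {}" if "e \<in> S" using NS[OF that] NQ[OF Q] neq[of e] by auto
    show "e \<in> {}" if "e \<in> P" using NPQ[OF that] NQ[OF Q] neq[of e] by auto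
  qed
  have finP: "finite P" "finite Q" using fin by (simp_all add: P_def Q_def)
  have "card (Z \<union> S \<union> P \<union> Q) = card Z + card S + card P + card Q"
    using card_Un_disjoint[OF _ finP(2) ZSPQ] card_Un_disjoint[OF _ finP(1) ZSP]
      card_Un_disjoint[OF fin ZS] fin finP by simp
  also have "\<dots> = card S + 3 * card Z"
    using inj by (simp add: P_def Q_def card_image)
  finally have "card (Z \<union> S \<union> P \<union> Q) = card S + 3 * card Z" .
  moreover have "Z \<union> S \<union> P \<union> Q \<subseteq> {0..<k}"
    using Zr Sr NPQ NQ by auto
  then have "card (Z \<union> S \<union> P \<union> Q) \<le> card {0..<k}"
    by (intro card_mono) simp_all
  ultimately have "card S + 3 * card Z \<le> nat k"
    by simp
  then show ?thesis using k by (simp add: Z_def le_nat_iff)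
qed

subsection \<open>Critical colorings of iterated Mycielskians of complete graphs\<close>

text \<open>
  In this locale \<open>S\<close> consists of the colors of the vertices of \<open>K\<^sub>n\<close>, \<open>Z\<close> of the colors close to two
  of them, and \<open>M\<close> of those elements of \<open>Z\<close> that are not close to the last apex. By
  \<open>vertex_on_Z\<close> the colors in \<open>Z\<close> occur only on vertices descending from an apex. The set \<open>D\<close>
  (with \<open>t\<close> one less than in \<open>theorem1\<close>) measures by how much \<open>M\<close> misses the trivial bound \<open>2 ^ t - 1\<close>.
\<close>

locale critical_coloring =
  fixes G :: "'a vert pair_pre_digraph" and n t :: nat and k d :: int and f :: "'a vert \<Rightarrow> int"
    and H :: "'a vert pair_pre_digraph"
  defines "H \<equiv> (mycielskian ^^ t) G"
  assumes complete: "K\<^bsub>n\<^esub> (with_proj G)" and n: "4 < n"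
    and d: "2 \<le> d"
    and f: "circular_coloring k d (mycielskian H) f"
    and normal: "\<And>x. f (Twin x) = f (Orig x) \<or> \<not> far k d (f (Orig x)) (f Apex)"
    and critical: "\<And>g. circular_coloring k d (mycielskian H) g \<Longrightarrow> {0..<k} \<subseteq> g ` pverts (mycielskian H)"
begin

definition S :: "int set" where
  "S = (\<lambda>x. f ((Orig ^^ Suc t) x)) ` pverts G"

definition Z :: "int set" where
  "Z = near_two k d S"

lemma graph_H: "pair_graph H"
  using complete_digraphD(1)[OF complete] unfolding H_def by (rule pair_graph_mycielskian_funpow)

lemma graph_MH: "pair_graph (mycielskian H)"
  by (rule pair_graph_mycielskian[OF graph_H])

lemma mycielskian_H: "mycielskian H = (mycielskian ^^ Suc t) G"
  by (simp add: H_def)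

lemma f_range: "v \<in> pverts (mycielskian H) \<Longrightarrow> f v \<in> {0..<k}"
  using f by (simp add: circular_coloring_iff)

lemma f_far: "(u, v) \<in> parcs (mycielskian H) \<Longrightarrow> far k d (f u) (f v)"
  using f by (simp add: circular_coloring_iff)

lemma color_used:
  assumes "circular_coloring k d (mycielskian H) g" "q \<in> {0..<k}"
  obtains v where "v \<in> pverts (mycielskian H)" "g v = q"
  using critical[OF assms(1)] assms(2) by auto

lemma copy_far_center:
  assumes "x \<in> pverts G" "y \<in> pverts G" "x \<noteq> y" "v \<in> copies (Suc t) x"
  shows "far k d (f v) (f ((Orig ^^ Suc t) y))"
proof -
  have "(x, y) \<in> parcs G" using complete_digraphD(4)[OF complete] assms by simp
  from copies_adjacent_Orig[OF this assms(4)] show ?thesis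
    using f_far by (simp add: mycielskian_H)
qed

lemma center_far:
  "x \<in> pverts G \<Longrightarrow> y \<in> pverts G \<Longrightarrow> x \<noteq> y \<Longrightarrow>
    far k d (f ((Orig ^^ Suc t) x)) (f ((Orig ^^ Suc t) y))"
  by (rule copy_far_center[OF _ _ _ funpow_Orig_in_copies])

lemma not_far_self: "\<not> far k d a a"
  using d by (simp add: far_def)

lemma inj_center: "inj_on (\<lambda>x. f ((Orig ^^ Suc t) x)) (pverts G)"
proof (rule inj_onI, rule ccontr)
  fix x y assume xy: "x \<in> pverts G" "y \<in> pverts G" "x \<noteq> y"
    and eq: "f ((Orig ^^ Suc t) x) = f ((Orig ^^ Suc t) y)"
  show False using center_far[OF xy] unfolding eq by (simp add: not_far_self)
qed

lemma card_S: "card S = n"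
  using card_image[OF inj_center] complete_digraphD(3)[OF complete] by (simp add: S_def)

lemma center_range: "x \<in> pverts G \<Longrightarrow> f ((Orig ^^ Suc t) x) \<in> {0..<k}"
  using funpow_Orig_in_pverts[of x G "Suc t"] f_range by (simp add: mycielskian_H)

lemma separated_S: "separated k d S"
  unfolding separated_def
proof (intro conjI ballI impI)
  show "S \<subseteq> {0..<k}" unfolding S_def using center_range by blast
  show "far k d a b" if ab: "a \<in> S" "b \<in> S" "a \<noteq> b" for a b
  proof -
    obtain x y where "x \<in> pverts G" "y \<in> pverts G" "a = f ((Orig ^^ Suc t) x)" "b = f ((Orig ^^ Suc t) y)"
      using ab unfolding S_def by blast
    then show ?thesis using center_far[of x y] ab(3) by auto
  qed
qed

lemma k_ge: "2 * d \<le> k"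
proof -
  have "2 \<le> card S" using card_S n by simp
  then obtain T where "T \<subseteq> S" "card T = 2"
    by (meson obtain_subset_with_card_n)
  then obtain a b where "a \<in> S" "b \<in> S" "a \<noteq> b"
    by (auto simp: card_2_iff)
  then have "far k d a b" using separated_S by (auto simp: separated_def)
  then show ?thesis by (auto simp: far_def)
qed

lemma Z_range: "Z \<subseteq> {0..<k}"
  by (auto simp: Z_def near_two_def)

lemma vertex_on_Z:
  assumes "v \<in> pverts (mycielskian H)" "f v \<in> Z"
  shows "v \<in> apexes (Suc t)"
proof (rule ccontr)
  assume "v \<notin> apexes (Suc t)"
  then obtain x where x: "x \<in> pverts G" "v \<in> copies (Suc t) x"
    using assms(1) pverts_iterated[of "Suc t" G] unfolding mycielskian_H by auto
  obtain a b where ab: "a \<in> S" "b \<in> S" "a \<noteq> b" "\<not> far k d (f v) a" "\<not> far k d (f v) b"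
    using assms(2) by (auto simp: Z_def near_two_def)
  then obtain y z where yz: "y \<in> pverts G" "z \<in> pverts G"
      "a = f ((Orig ^^ Suc t) y)" "b = f ((Orig ^^ Suc t) z)"
    unfolding S_def by blast
  have "x = y" using copy_far_center[OF x(1) yz(1) _ x(2)] ab(4) yz(3) by blast
  moreover have "x = z" using copy_far_center[OF x(1) yz(2) _ x(2)] ab(5) yz(4) by blast
  ultimately show False using ab(3) yz by simp
qed

text \<open>By criticality \<open>q\<close> occurs, on a descendant of an apex. This is not
  \<open>Apex\<close>, and \<open>normal\<close> passes the color from \<open>Orig y\<close> to
  \<open>Twin y\<close>.\<close>

lemma twin_on_Z:
  assumes "q \<in> Z" "far k d q (f Apex)"
  obtains y where "y \<in> apexes t" "f (Twin y) = q"
proof -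
  obtain v where v: "v \<in> pverts (mycielskian H)" "f v = q"
    by (rule color_used[OF f, of q]) (use assms(1) Z_range in auto)
  then have "v \<in> apexes (Suc t)" using vertex_on_Z assms(1) by simp
  then consider "v = Apex" | y where "y \<in> apexes t" "v = Orig y" | y where "y \<in> apexes t" "v = Twin y"
    by auto
  then show ?thesis
  proof cases
    case 1
    then show ?thesis using v assms(2) not_far_self by simp
  next
    case 2
    then have "f (Twin y) = q" using normal[of y] v assms(2) by auto
    then show ?thesis using that 2 by blast
  next
    case 3
    then show ?thesis using that v by simp
  qed
qed

definition M :: "int set" where
  "M = {q \<in> Z. far k d q (f Apex)}"

text \<open>Distinct colors of \<open>M\<close> have distinct owners, which bounds \<open>M\<close>
  by \<open>apexes t\<close> and makes \<open>D\<close> count exactly the deficit.\<close>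

definition owner :: "int \<Rightarrow> 'a vert" where
  "owner q = (SOME y. y \<in> apexes t \<and> f (Twin y) = q)"

lemma owner: "q \<in> M \<Longrightarrow> owner q \<in> apexes t \<and> f (Twin (owner q)) = q"
  unfolding owner_def by (rule someI_ex) (use twin_on_Z in \<open>auto simp: M_def\<close>)

lemma inj_owner: "inj_on owner M"
  by (rule inj_on_inverseI[where g = "\<lambda>y. f (Twin y)"]) (use owner in simp)

definition D :: "'a vert set" where
  "D = apexes t - owner ` M"

lemma card_M: "card M + card D = 2 ^ t - 1"
proof -
  have fin: "finite (apexes t :: 'a vert set)" "card (apexes t :: 'a vert set) = 2 ^ t - 1"
    using card_apexes by auto
  have sub: "owner ` M \<subseteq> apexes t" using owner by auto
  have "card D = card (apexes t :: 'a vert set) - card (owner ` M)"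
    unfolding D_def using sub fin by (intro card_Diff_subset) (auto intro: finite_subset)
  moreover have "card (owner ` M) \<le> card (apexes t :: 'a vert set)"
    using sub fin by (intro card_mono)
  ultimately show ?thesis using fin card_image[OF inj_owner] by simp
qed

lemma Apex_range: "f Apex \<in> {0..<k}"
  by (rule f_range) simp

lemma finite_Z: "finite Z"
  using finite_subset[OF Z_range] by simp

lemma card_Z_le: "card Z \<le> card M + card {q \<in> Z. \<not> far k d q (f Apex)}"
proof -
  have "Z = M \<union> {q \<in> Z. \<not> far k d q (f Apex)}" by (auto simp: M_def)
  then have "card Z = card (M \<union> {q \<in> Z. \<not> far k d q (f Apex)})" by simp
  also have "\<dots> \<le> card M + card {q \<in> Z. \<not> far k d q (f Apex)}" by (rule card_Un_le)
  finally show ?thesis .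
qed

lemma card_near_Apex: "int (card {q \<in> Z. \<not> far k d q (f Apex)}) \<le> 2 * d - 1"
proof -
  have "card {q \<in> Z. \<not> far k d q (f Apex)} \<le> card {q \<in> {0..<k}. \<not> far k d q (f Apex)}"
    using Z_range by (intro card_mono) (auto intro: finite_subset[of _ "{0..<k}"])
  then show ?thesis using card_near[OF Apex_range _ k_ge] d by simp
qed

lemma card_Z_ge: "int n * (2 * d - 1) + int (card (far_all k d S)) \<le> k + int (card Z)"
  using card_near_two[OF separated_S _ k_ge] d card_S unfolding Z_def by simp

lemma general_bound: "int n * (2 * d - 1) - k \<le> 2 ^ t - 1 + (2 * d - 1)"
proof -
  have "int (card M) \<le> 2 ^ t - 1"
  proof -
    have "int (2 ^ t - 1) = 2 ^ t - 1" by (simp add: of_nat_diff)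
    then show ?thesis using card_M by linarith
  qed
  then show ?thesis
    using card_Z_ge card_Z_le card_near_Apex by linarith
qed

end

section \<open>Vacating a color by moves over a descendant of an apex\<close>

lemma Twin_Twin_neighbour:
  assumes "(Twin (Twin y), w) \<in> parcs (mycielskian (mycielskian L))"
  shows "w = Apex \<or> w = Orig Apex \<or> (Twin (Orig y), w) \<in> parcs (mycielskian (mycielskian L))"
proof (cases w)
  case (Orig z)
  then show ?thesis using assms by (cases z) auto
qed (use assms in auto)

text \<open>Limits the conflicts when \<open>Orig (Twin y)\<close> takes the color of
  \<open>Orig (Orig y)\<close> to the two vertices over the inner apex.\<close>

lemma Orig_Twin_neighbour:
  assumes "pair_graph L" "(Orig (Twin y), w) \<in> parcs (mycielskian (mycielskian L))"
  shows "w = Orig Apex \<or> w = Twin Apex \<or> (Orig (Orig y), w) \<in> parcs (mycielskian (mycielskian L))"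
proof (cases w)
  case (Orig z)
  then show ?thesis using assms by (cases z) auto
next
  case (Twin z)
  then show ?thesis using assms parcs_sym[OF assms(1)] by (cases z) auto
qed (use assms in auto)

lemma Twin_Orig_Twin_neighbour:
  assumes L: "pair_graph L" and w: "(Twin (Orig (Twin x)), w) \<in> parcs (mycielskian (mycielskian (mycielskian L)))"
  shows "w = Orig (Orig Apex) \<or> w = Orig (Twin Apex) \<or>
    (Twin (Orig (Orig x)), w) \<in> parcs (mycielskian (mycielskian (mycielskian L)))"
proof (cases w)
  case (Orig z)
  then have "(Orig (Twin x), z) \<in> parcs (mycielskian (mycielskian L))" using w by simp
  from Orig_Twin_neighbour[OF L this] show ?thesis using Orig by auto
next
  case Apex
  then show ?thesis using w by simp
qed (use w in auto)

context critical_coloring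
begin

text \<open>An original colored \<open>q\<close> passes this color to its twin by
  \<open>normal\<close>. So if \<open>y\<close> alone has a twin colored \<open>q\<close>,
  recoloring the two vertices over \<open>y\<close> vacates \<open>q\<close>.\<close>

lemma vertex_on_M:
  assumes q: "q \<in> M" and y: "\<And>y'. y' \<in> apexes t \<Longrightarrow> f (Twin y') = q \<Longrightarrow> y' = y"
    and v: "v \<in> pverts (mycielskian H)" "f v = q"
  shows "v = Twin y \<or> v = Orig y"
proof -
  have "v \<in> apexes (Suc t)" using vertex_on_Z v q by (simp add: M_def)
  then consider "v = Apex" | z where "z \<in> apexes t" "v = Orig z" | z where "z \<in> apexes t" "v = Twin z"
    by auto
  then show ?thesis
  proof cases
    case 1
    then show ?thesis using v q not_far_self by (auto simp: M_def)
  next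
    case 2
    then have "f (Twin z) = q" using normal[of z] v q by (auto simp: M_def)
    then show ?thesis using 2 y by auto
  next
    case 3
    then show ?thesis using v y by auto
  qed
qed

text \<open>
  Moving the two vertices over \<open>Twin (Twin x)\<close> to the colors of the corresponding vertices over
  \<open>Orig (Twin x)\<close> must not vacate a color; so \<open>Orig (Orig (Twin x))\<close> is close to one of the two
  vertices over the second apex, and then moving \<open>Twin (Orig (Twin x))\<close> vacates a color.
\<close>

lemma vacating_moves:
  assumes t: "t = Suc (Suc r)" and x: "x \<in> apexes r"
    and M0: "f (Twin (Orig (Twin x))) \<in> M" and M1: "f (Twin (Twin (Twin x))) \<in> M"
    and ex0: "\<And>y. y \<in> apexes t \<Longrightarrow> f (Twin y) = f (Twin (Orig (Twin x))) \<Longrightarrow> y = Orig (Twin x)"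
    and ex1: "\<And>y. y \<in> apexes t \<Longrightarrow> f (Twin y) = f (Twin (Twin (Twin x))) \<Longrightarrow> y = Twin (Twin x)"
    and far0: "far k d (f (Twin (Orig (Twin x)))) (f (Orig Apex))" "far k d (f (Twin (Orig (Twin x)))) (f (Twin Apex))"
    and far1: "far k d (f (Twin (Orig (Orig x)))) (f (Orig (Orig Apex)))"
      "far k d (f (Twin (Orig (Orig x)))) (f (Orig (Twin Apex)))"
  shows False
proof -
  define L where "L = (mycielskian ^^ r) G"
  have H: "H = mycielskian (mycielskian L)" by (simp add: H_def t L_def)
  have L: "pair_graph L"
    using complete_digraphD(1)[OF complete] unfolding L_def by (rule pair_graph_mycielskian_funpow)
  note graph_ML = pair_graph_mycielskian[OF L]
  have xL: "x \<in> pverts L" using x apexes_subset[of r G] by (auto simp: L_def)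
  have rg: "f v \<in> {0..<k}" if "v \<in> {Twin (Orig (Twin x)), Orig (Orig (Twin x)), Twin (Orig (Orig x))}" for v
    using that xL by (intro f_range) (auto simp: H)
  have y: "Orig (Twin x) \<in> apexes t" "Orig (Orig x) \<in> apexes t"
    using x by (auto simp: t)
  let ?m0 = "f (Twin (Orig (Twin x)))" and ?m1 = "f (Twin (Twin (Twin x)))"
  have m: "?m0 \<in> {0..<k}" "?m1 \<in> {0..<k}" using M0 M1 Z_range by (auto simp: M_def)
  define f1 where "f1 = f(Twin (Twin (Twin x)) := ?m0)"
  have f1: "circular_coloring k d (mycielskian H) f1"
    unfolding f1_def
  proof (rule circular_coloring_update[OF graph_MH f m(1)])
    fix w assume "(Twin (Twin (Twin x)), w) \<in> parcs (mycielskian H)"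
    then consider "w = Apex" | "w = Orig Apex" | "(Twin (Orig (Twin x)), w) \<in> parcs (mycielskian H)"
      using Twin_Twin_neighbour unfolding H by blast
    then show "far k d ?m0 (f w)"
      using M0 far0 f_far by cases (auto simp: M_def)
  qed
  have m01: "?m0 \<noteq> ?m1" using ex1[OF y(1)] by auto
  \<comment> \<open>\<open>f1\<close> still uses \<open>?m1\<close>, and
    \<open>Orig (Twin (Twin x))\<close> is the only carrier left.\<close>
  have m1: "f (Orig (Twin (Twin x))) = ?m1"
  proof -
    obtain v where v: "v \<in> pverts (mycielskian H)" "f1 v = ?m1"
      using color_used[OF f1 m(2)] .
    then have "v \<noteq> Twin (Twin (Twin x))" using m01 by (auto simp: f1_def)
    then have "f v = ?m1" using v by (simp add: f1_def)
    with vertex_on_M[OF M1 ex1 v(1)] \<open>v \<noteq> Twin (Twin (Twin x))\<close> show ?thesis by auto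
  qed
  define c where "c = f (Orig (Orig (Twin x)))"
  have c: "\<not> far k d c (f (Orig Apex)) \<or> \<not> far k d c (f (Twin Apex))"
  proof (rule ccontr)
    assume "\<not> ?thesis"
    then have cf: "far k d c (f (Orig Apex))" "far k d c (f (Twin Apex))" by auto
    \<comment> \<open>Both possible carriers of \<open>?m1\<close> are now recolored, and neither
      with \<open>?m1\<close>, against criticality.\<close>
    define f2 where "f2 = f1(Orig (Twin (Twin x)) := c)"
    have "circular_coloring k d (mycielskian H) f2"
      unfolding f2_def
    proof (rule circular_coloring_update[OF graph_MH f1])
      show "c \<in> {0..<k}" using rg by (simp add: c_def)
      fix w assume w: "(Orig (Twin (Twin x)), w) \<in> parcs (mycielskian H)"
      then have "w \<noteq> Twin (Twin (Twin x))" using parcs_irrefl[OF graph_ML] by (auto simp: H)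
      moreover consider "w = Orig Apex" | "w = Twin Apex" | "(Orig (Orig (Twin x)), w) \<in> parcs (mycielskian H)"
        using Orig_Twin_neighbour[OF graph_ML] w unfolding H by blast
      then have "far k d c (f w)"
        using cf f_far by cases (auto simp: c_def)
      ultimately show "far k d c (f1 w)" by (simp add: f1_def)
    qed
    from color_used[OF this m(2)] obtain v where v: "v \<in> pverts (mycielskian H)" "f2 v = ?m1" .
    have "c \<noteq> ?m1"
    proof
      assume "c = ?m1"
      then have "f (Orig (Orig (Twin x))) = ?m1" by (simp add: c_def)
      moreover have "Orig (Orig (Twin x)) \<in> pverts (mycielskian H)" using xL by (simp add: H)
      ultimately show False using vertex_on_M[OF M1 ex1] by blast
    qed
    then have "v \<noteq> Orig (Twin (Twin x))" "v \<noteq> Twin (Twin (Twin x))"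
      using v m01 by (auto simp: f2_def f1_def split: if_splits)
    moreover from this have "f v = ?m1" using v by (simp add: f2_def f1_def)
    ultimately show False using vertex_on_M[OF M1 ex1 v(1)] by blast
  qed
  \<comment> \<open>After this move only \<open>Orig (Orig (Twin x))\<close> can carry
    \<open>?m0\<close>, that is \<open>c = ?m0\<close>; but \<open>c\<close> is close to a vertex
    over the second apex, against \<open>far0\<close>.\<close>
  define f3 where "f3 = f(Twin (Orig (Twin x)) := f (Twin (Orig (Orig x))))"
  have "circular_coloring k d (mycielskian H) f3"
    unfolding f3_def
  proof (rule circular_coloring_update[OF graph_MH f])
    show "f (Twin (Orig (Orig x))) \<in> {0..<k}" using rg by simp
    fix w assume "(Twin (Orig (Twin x)), w) \<in> parcs (mycielskian H)"
    then consider "w = Orig (Orig Apex)" | "w = Orig (Twin Apex)" | "(Twin (Orig (Orig x)), w) \<in> parcs (mycielskian H)"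
      using Twin_Orig_Twin_neighbour[OF L] unfolding H by blast
    then show "far k d (f (Twin (Orig (Orig x)))) (f w)"
      using far1 f_far by cases auto
  qed
  from color_used[OF this m(1)] obtain v where v: "v \<in> pverts (mycielskian H)" "f3 v = ?m0" .
  have "f (Twin (Orig (Orig x))) \<noteq> ?m0" using ex0[OF y(2)] by auto
  then have v': "v \<noteq> Twin (Orig (Twin x))" using v by (auto simp: f3_def)
  then have "f v = ?m0" using v by (simp add: f3_def)
  then have "c = ?m0" using vertex_on_M[OF M0 ex0 v(1)] v' by (auto simp: c_def)
  then show False using c far0 by simp
qed

end

section \<open>Charging losses, and the bounds for denominator 2\<close>

lemma nxt_prv_near:
  assumes "4 < k" "p \<in> {0..<k}" "b \<in> {0..<k}" "q \<in> {0..<k}"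
    "\<not> far k 2 b p" "\<not> far k 2 q b" "far k 2 q p"
  shows "q = nxt k (nxt k p) \<or> q = prv k (prv k p)"
proof -
  have b: "b = p \<or> b = nxt k p \<or> b = prv k p"
    using assms not_far_2_iff[of p k b] by (auto simp: far_commute)
  have q: "q = b \<or> q = nxt k b \<or> q = prv k b"
    using assms not_far_2_iff[of b k q] by (auto simp: far_commute)
  have "q \<noteq> p" "q \<noteq> nxt k p" "q \<noteq> prv k p"
    using assms not_far_2_iff[of q k p] not_far_2_iff[of p k q] by (auto simp: far_commute)
  then show ?thesis using b q nxt_prv_range[OF assms(2)] by auto
qed

lemma charge_image_card:
  assumes "A \<subseteq> g ` (D \<union> h ` E)" "finite D" "finite E" "card E \<le> m"
  shows "card A \<le> card D + m"
proof -
  have "card A \<le> card (g ` (D \<union> h ` E))"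
    using assms by (intro card_mono) auto
  also have "\<dots> \<le> card (D \<union> h ` E)"
    using assms by (intro card_image_le) auto
  also have "\<dots> \<le> card D + card (h ` E)"
    by (rule card_Un_le)
  also have "\<dots> \<le> card D + card E"
    using assms(3) by (simp add: card_image_le)
  finally show ?thesis using assms(4) by simp
qed

text \<open>Undoes the last two Mycielski steps; vertices without two steps to undo get the default
  value \<open>Apex\<close>.\<close>

fun grandparent :: "'a vert \<Rightarrow> 'a vert" where
  "grandparent (Orig (Orig x)) = x"
| "grandparent (Orig (Twin x)) = x"
| "grandparent (Twin (Orig x)) = x"
| "grandparent (Twin (Twin x)) = x"
| "grandparent _ = Apex"

context critical_coloring
begin

text \<open>Combine the count \<open>card_Z_ge\<close> with the trivial bound of
  \<open>card Z\<close> by \<open>k\<close>.\<close>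

lemma k_gt_4: "4 < k"
proof -
  have "card Z \<le> card {0..<k}"
    using Z_range by (intro card_mono) auto
  then have "int (card Z) \<le> k" using k_ge d by simp
  then have "int n * (2 * d - 1) \<le> 2 * k" using card_Z_ge by linarith
  moreover have "int n * 3 \<le> int n * (2 * d - 1)" using d by (intro mult_left_mono) auto
  ultimately show ?thesis using n by linarith
qed

text \<open>A color \<open>q\<close> of \<open>Z\<close> sits on an apex descendant, which has a
  neighbor \<open>w\<close> among the copies of any chosen center. The color of \<open>w\<close> is
  far from \<open>q\<close> and from all other centers, as \<open>card_near_two_if_no_far\<close>
  requires.\<close>

lemma no_far_bound:
  assumes d2: "d = 2" and none: "far_all k 2 S = {}"
  shows "10 * int n \<le> 4 * k"
proof -
  have S2: "separated k 2 S" using separated_S d2 by simp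
  have near: "\<exists>e \<in> {0..<k}. far k 2 e q \<and> (\<forall>s \<in> S. s \<noteq> a \<longrightarrow> far k 2 e s)"
    if q: "q \<in> near_two k 2 S" and a: "a \<in> S" for q a
  proof -
    obtain v where v: "v \<in> pverts (mycielskian H)" "f v = q"
      by (rule color_used[OF f, of q]) (use q in \<open>auto simp: near_two_def\<close>)
    moreover have "q \<in> Z" using q unfolding Z_def by (simp only: d2)
    ultimately have u: "v \<in> apexes (Suc t)" using vertex_on_Z by blast
    obtain x where x: "x \<in> pverts G" "a = f ((Orig ^^ Suc t) x)"
      using a unfolding S_def by blast
    obtain w where w: "w \<in> copies (Suc t) x" "(v, w) \<in> parcs (mycielskian H)"
      using apexes_adjacent_copies[OF u x(1)] unfolding mycielskian_H by blast
    have "f w \<in> {0..<k}" using f_range parcs_wf(2)[OF graph_MH w(2)] by blast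
    moreover have "far k 2 (f w) q" using f_far[OF w(2)] v d2 by (simp add: far_commute)
    moreover have "far k 2 (f w) s" if s: "s \<in> S" "s \<noteq> a" for s
    proof -
      obtain y where y: "y \<in> pverts G" "s = f ((Orig ^^ Suc t) y)"
        using s unfolding S_def by blast
      then show ?thesis using copy_far_center[OF x(1) y(1) _ w(1)] s(2) x(2) d2 by auto
    qed
    ultimately show ?thesis by blast
  qed
  have "int (card S) + 3 * int (card (near_two k 2 S)) \<le> k"
    by (rule card_near_two_if_no_far[OF S2 k_gt_4 none])
      (use near near_two_2[OF S2 k_gt_4] in blast)+
  moreover have "int n * 3 \<le> k + int (card (near_two k 2 S))"
    using card_Z_ge[unfolded Z_def] by (simp add: d2)
  ultimately show ?thesis using card_S by simp
qed

lemma separated_Z: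
  assumes "d = 2"
  shows "separated k 2 Z"
  unfolding Z_def using separated_near_two[of k S] separated_S k_gt_4 assms by simp

lemma card_Z_near:
  assumes "d = 2" "q \<in> {0..<k}"
  shows "card {z \<in> Z. \<not> far k 2 q z} \<le> 2"
  using separated_near_card[OF separated_Z[OF assms(1)] assms(2)] k_gt_4 by simp

text \<open>
  The vertices over \<open>x \<in> apexes r\<close> satisfy the hypotheses of \<open>vacating_moves\<close> unless one of three
  of them lies in \<open>D\<close>, or owns a color close to an element of \<open>D\<close> or at distance 2 from the last
  apex; every element of \<open>D\<close> is close to at most two colors in \<open>M\<close>.
\<close>

lemma charging:
  assumes d2: "d = 2" and t: "t = Suc (Suc r)"
  shows "2 ^ r - 1 \<le> 3 * card D + 2"
proof -
  define p where "p = f Apex"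
  have p: "p \<in> {0..<k}" using Apex_range by (simp add: p_def)
  define E where "E = {q \<in> M. (\<exists>y \<in> D. \<not> far k 2 (f (Twin y)) q) \<or> q = nxt k (nxt k p) \<or> q = prv k (prv k p)}"
  have MZ: "M \<subseteq> Z" by (auto simp: M_def)
  have Tr: "f (Twin y) \<in> {0..<k}" "f (Orig y) \<in> {0..<k}" if "y \<in> apexes t" for y
    using that apexes_subset[of t G] by (auto intro!: f_range[unfolded atLeastLessThan_iff] simp: H_def)
  have DA: "D \<subseteq> apexes t" by (auto simp: D_def)
  have finD: "finite D" using DA card_apexes finite_subset by blast
  have "E \<subseteq> (\<Union>y \<in> D. {z \<in> Z. \<not> far k 2 (f (Twin y)) z}) \<union> {nxt k (nxt k p), prv k (prv k p)}"
    using MZ by (auto simp: E_def)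
  moreover have fin: "finite ((\<Union>y \<in> D. {z \<in> Z. \<not> far k 2 (f (Twin y)) z}) \<union> {nxt k (nxt k p), prv k (prv k p)})"
    using finD finite_Z by auto
  ultimately have "card E \<le> card ((\<Union>y \<in> D. {z \<in> Z. \<not> far k 2 (f (Twin y)) z}) \<union> {nxt k (nxt k p), prv k (prv k p)})"
    by (intro card_mono)
  also have "\<dots> \<le> card (\<Union>y \<in> D. {z \<in> Z. \<not> far k 2 (f (Twin y)) z}) + card {nxt k (nxt k p), prv k (prv k p)}"
    by (rule card_Un_le)
  also have "\<dots> \<le> (\<Sum>y \<in> D. card {z \<in> Z. \<not> far k 2 (f (Twin y)) z}) + 2"
    using card_UN_le[OF finD] by (intro add_mono) (auto simp: card_insert_if)
  also have "\<dots> \<le> (\<Sum>y \<in> D. 2) + 2"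
    using card_Z_near[OF d2] Tr DA by (intro add_mono sum_mono) auto
  finally have cardE: "card E \<le> 2 * card D + 2" by simp
  have finE: "finite E" using finite_Z MZ by (auto simp: E_def intro: finite_subset)
  have self: "\<not> far k 2 a a" for a using not_far_self d2 by auto
  have "apexes r \<subseteq> grandparent ` (D \<union> owner ` E)"
  proof
    fix x :: "'a vert" assume x: "x \<in> apexes r"
    show "x \<in> grandparent ` (D \<union> owner ` E)"
    proof (rule ccontr)
      assume not: "x \<notin> grandparent ` (D \<union> owner ` E)"
      \<comment> \<open>The twins of these vertices carry the three colors that
        \<open>vacating_moves\<close> constrains.\<close>
      define Y where "Y = {Orig (Orig x), Orig (Twin x), Twin (Twin x)}"
      have YA: "Y \<subseteq> apexes t" using x by (auto simp: Y_def t)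
      have "grandparent y = x" if "y \<in> Y" for y using that by (auto simp: Y_def)
      then have YD: "y \<notin> D \<union> owner ` E" if "y \<in> Y" for y using not that by blast
      have YM: "f (Twin y) \<in> M \<and> f (Twin y) \<notin> E \<and> owner (f (Twin y)) = y" if y: "y \<in> Y" for y
      proof -
        obtain q where q: "q \<in> M" "y = owner q" using YD[OF y] YA y by (auto simp: D_def)
        then show ?thesis using owner[OF q(1)] YD[OF y] by auto
      qed
      have D_far: "far k 2 (f (Twin y)) (f (Twin z))" if "y \<in> Y" "z \<in> D" for y z
        using YM[OF that(1)] that(2) by (auto simp: E_def far_commute)
      have ex: "y' = y" if y: "y \<in> Y" and y': "y' \<in> apexes t" "f (Twin y') = f (Twin y)" for y y'
      proof (cases "y' \<in> D")
        case True
        then show ?thesis using D_far[OF y True] y' self by simp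
      next
        case False
        then obtain q where "q \<in> M" "y' = owner q" using y'(1) by (auto simp: D_def)
        then show ?thesis using owner[of q] y' YM[OF y] by auto
      qed
      have far_Twin: "far k 2 (f (Twin y)) (f (Twin z))" if y: "y \<in> Y" and z: "z \<in> apexes t" "z \<notin> Y" for y z
      proof (cases "z \<in> D")
        case True
        then show ?thesis using D_far[OF y] by simp
      next
        case False
        then obtain q where q: "q \<in> M" "z = owner q" using z(1) by (auto simp: D_def)
        then have "f (Twin z) \<in> Z" using owner[OF q(1)] MZ by auto
        moreover have "f (Twin y) \<in> Z" using YM[OF y] MZ by auto
        moreover have "f (Twin z) \<noteq> f (Twin y)" using ex[OF y z(1)] z(2) y by auto
        ultimately show ?thesis using separated_Z[OF d2] unfolding separated_def by metis
      qed
      \<comment> \<open>An original whose color differs from that of its twin is close to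
        \<open>p\<close>. A color close to it but far from \<open>p\<close> is at distance 2 from
        \<open>p\<close>, which \<open>E\<close> excludes.\<close>
      have far_Orig: "far k 2 (f (Twin y)) (f (Orig z))" if y: "y \<in> Y" and z: "z \<in> apexes t" "z \<notin> Y" for y z
      proof (cases "f (Twin z) = f (Orig z)")
        case True
        then show ?thesis using far_Twin[OF that] by simp
      next
        case False
        then have zp: "\<not> far k 2 (f (Orig z)) p" using normal[of z] d2 by (auto simp: p_def)
        show ?thesis
        proof (rule ccontr)
          assume n: "\<not> far k 2 (f (Twin y)) (f (Orig z))"
          have "far k d (f (Twin y)) (f Apex)" using YM[OF y] by (auto simp: M_def)
          then have yp: "far k 2 (f (Twin y)) p" unfolding p_def by (simp only: d2)
          have "f (Twin y) = nxt k (nxt k p) \<or> f (Twin y) = prv k (prv k p)"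
            by (rule nxt_prv_near[OF k_gt_4 p _ _ zp n yp]) (use Tr y z YA in blast)+
          then show False using YM[OF y] by (auto simp: E_def)
        qed
      qed
      have z: "z \<in> apexes t \<and> z \<notin> Y" if "z \<in> {Apex, Orig Apex, Twin Apex}" for z
        using that by (auto simp: t Y_def)
      show False
        by (rule vacating_moves[OF t x]) (use YM ex far_Twin far_Orig z d2 in \<open>simp_all add: Y_def\<close>)
    qed
  qed
  from charge_image_card[OF this finD finE cardE] show ?thesis
    using card_apexes[of r, where ?'a = 'a] by simp
qed

text \<open>Three gains over \<open>general_bound\<close>: a color in \<open>far_all\<close> adds
  one to the count, the separated set \<open>Z\<close> has at most two colors close to the last
  apex, and \<open>charging\<close> forces \<open>D\<close> to be large.\<close>

lemma tight_bound:
  assumes d2: "d = 2" and t: "t = Suc (Suc r)" and far: "far_all k 2 S \<noteq> {}"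
  shows "9 * int n + 2 ^ r \<le> 3 * k + 3 * 2 ^ t + 3"
proof -
  have "finite (far_all k 2 S)" by (auto simp: far_all_def intro: finite_subset[of _ "{0..<k}"])
  then have "1 \<le> card (far_all k 2 S)" using far by (simp add: Suc_leI card_gt_0_iff)
  then have "int n * 3 + 1 \<le> k + int (card Z)" using card_Z_ge d2 by simp
  moreover have "card {q \<in> Z. \<not> far k d q (f Apex)} \<le> 2"
    using card_Z_near[OF d2 Apex_range] d2 by (simp add: far_commute)
  then have "card Z \<le> card M + 2" using card_Z_le by linarith
  moreover have "int (card M) + int (card D) = 2 ^ t - 1"
  proof -
    have "int (2 ^ t - 1) = 2 ^ t - 1" by (simp add: of_nat_diff)
    then show ?thesis using card_M by linarith
  qed
  moreover have "2 ^ r - 1 \<le> 3 * int (card D) + 2"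
  proof -
    have "int (2 ^ r - 1) = 2 ^ r - 1" by (simp add: of_nat_diff)
    then show ?thesis using charging[OF d2 t] by linarith
  qed
  ultimately show ?thesis by linarith
qed

end

section \<open>The lower bound for all denominators, and the theorem\<close>

lemma circular_coloring_iterated_lower_bound:
  fixes G :: "'a vert pair_pre_digraph" and n t :: nat and k d :: int
  assumes K: "K\<^bsub>n\<^esub> (with_proj G)" and t4: "t \<ge> 4"
    and bound: "11 * 2 ^ (t - 1) + 24 * int t + 4 \<le> 12 * int n"
    and f: "circular_coloring k d ((mycielskian ^^ t) G) f" and d: "1 \<le> d"
  shows "(int n + int t) * d \<le> k"
proof (rule ccontr)
  assume "\<not> ?thesis"
  then have less: "k < (int n + int t) * d" by simp
  define s where "s = t - 1"
  define r where "r = t - 3"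
  have ts: "t = Suc s" "s = Suc (Suc r)" using t4 by (simp_all add: s_def r_def)
  define H where "H = (mycielskian ^^ s) G"
  have MH: "(mycielskian ^^ t) G = mycielskian H" by (simp add: ts(1) H_def)
  have graph: "pair_graph H" "pair_graph (mycielskian H)"
    using pair_graph_mycielskian_funpow[OF complete_digraphD(1)[OF K]] MH by (metis H_def)+
  have no: "\<not> circular_coloring j 1 (mycielskian H) g" if j: "j < int n + int t" for j g
  proof
    assume "circular_coloring j 1 (mycielskian H) g"
    then have "n + t \<le> nat j"
      using proper_coloring_of_circular_coloring[OF graph(2)] proper_coloring_iterated_iff[OF K, of "nat j" t] MH by metis
    then show False using j t4 by (cases "0 \<le> j") auto
  qed
  obtain k' d' f' where c: "circular_coloring k' d' (mycielskian H) f'" "2 \<le> d'" "k' < (int n + int t) * d'"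
    and crit: "\<And>g. circular_coloring k' d' (mycielskian H) g \<Longrightarrow> {0..<k'} \<subseteq> g ` pverts (mycielskian H)"
    using critical_pair_exists[OF _ no f[unfolded MH] d less]
      pair_graph.axioms[OF graph(2)] pair_digraph.axioms pair_fin_digraph.axioms by metis
  obtain g where g: "circular_coloring k' d' (mycielskian H) g"
    "\<And>x. g (Twin x) = g (Orig x) \<or> \<not> far k' d' (g (Orig x)) (g Apex)"
    using circular_coloring_mycielskian_normalize[OF graph(1) c(1)] by blast
  \<comment> \<open>The second estimate is \<open>t - 3 \<le> 2 ^ (t - 4)\<close> multiplied by
    8.\<close>
  have pow: "(2::int) ^ s = 4 * 2 ^ r" "(8::int) * int t - 24 \<le> 2 ^ s"
  proof -
    show "(2::int) ^ s = 4 * 2 ^ r" by (simp add: ts(2))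
    have "t - 4 < 2 ^ (t - 4)" by (rule less_exp)
    then have "int (t - 4) < int (2 ^ (t - 4))" by (simp only: of_nat_less_iff)
    moreover have "(2::int) ^ s = 8 * 2 ^ (t - 4)"
    proof -
      have "s = (t - 4) + 3" using t4 by (simp add: s_def)
      then show ?thesis by (simp add: power_add)
    qed
    ultimately show "8 * int t - 24 \<le> (2::int) ^ s" using t4 by simp
  qed
  have bnd: "11 * 2 ^ s + 24 * int t + 4 \<le> 12 * int n" using bound by (simp add: s_def)
  have t4': "4 \<le> int t" using t4 by simp
  have "4 < int n" using bnd pow(2) t4' by linarith
  then have n: "4 < n" by simp
  interpret critical_coloring G n s k' d' g H
    by unfold_locales (use K n c(2) g crit in \<open>auto simp: H_def\<close>)
  show False
  proof (cases "d' = 2")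
    case True
    have k': "k' \<le> 2 * int n + 2 * int t - 1" using c(3) True by simp
    show False
    proof (cases "far_all k' 2 S = {}")
      assume "far_all k' 2 S = {}"
      \<comment> \<open>This would give \<open>n \<le> 4 * t - 2\<close>.\<close>
      from no_far_bound[OF True this] show False using k' bnd pow(2) t4' by linarith
    next
      assume "far_all k' 2 S \<noteq> {}"
      \<comment> \<open>This would give \<open>3 * n \<le> 11 * 2 ^ r + 6 * t\<close>, while
        \<open>bnd\<close> gives one more as a lower bound; here the factor 11/12 is
        decisive.\<close>
      from tight_bound[OF True ts(2) this] show False using k' bnd pow(1) by linarith
    qed
  next
    case False
    then have e: "2 \<le> d' - 1" using c(2) by simp
    \<comment> \<open>The factor \<open>int n - int t - 2\<close> is nonnegative, so the smallest
      remaining denominator 3 is the worst case.\<close>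
    have "(int n - int t - 2) * 2 \<le> (int n - int t - 2) * (d' - 1)"
      using e bnd pow(2) t4' by (intro mult_left_mono) linarith+
    moreover have "(int n - int t - 2) * (d' - 1) \<le> 2 ^ s + int t - 1"
      using general_bound c(3) by (simp add: algebra_simps)
    ultimately have "(int n - int t - 2) * 2 \<le> 2 ^ s + int t - 1"
      by (rule order_trans)
    then have "2 * int n \<le> 2 ^ s + 3 * int t + 3" by simp
    then show False using bnd pow(2) t4' by linarith
  qed
qed

theorem theorem1:
  fixes G :: "'a vert pair_pre_digraph" and n t :: nat
  assumes "K\<^bsub>n\<^esub> (with_proj G)"
    and "t \<ge> 4"
    and "real n \<ge> 11 / 12 * 2 ^ (t - 1) + 2 * real t + 1 / 3"
  shows "circular_chromatic_number ((mycielskian ^^ t) G) = real (chromatic_number ((mycielskian ^^ t) G)) \<and>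
    chromatic_number ((mycielskian ^^ t) G) = n + t"
proof
  show chi: "chromatic_number ((mycielskian ^^ t) G) = n + t"
    by (rule chromatic_number_iterated[OF assms(1)])
  \<comment> \<open>The hypothesis multiplied by 12, to be read in the integers.\<close>
  have "real_of_int (11 * 2 ^ (t - 1) + 24 * int t + 4) \<le> real_of_int (12 * int n)"
    using assms(3) by simp
  then have bound: "11 * 2 ^ (t - 1) + 24 * int t + 4 \<le> 12 * int n"
    by (simp only: of_int_le_iff)
  have graph: "pair_graph ((mycielskian ^^ t) G)"
    by (rule pair_graph_mycielskian_funpow[OF complete_digraphD(1)[OF assms(1)]])
  let ?R = "{real_of_int k / real_of_int d | k d.
      k \<ge> 2 * d \<and> 2 * d \<ge> 2 \<and> (\<exists>f. circular_coloring k d ((mycielskian ^^ t) G) f)}"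
  obtain f where "proper_coloring (n + t) ((mycielskian ^^ t) G) f"
    using proper_coloring_iterated_iff[OF assms(1)] by blast
  then have "circular_coloring (int (n + t)) 1 ((mycielskian ^^ t) G) (int \<circ> f)"
    by (rule circular_coloring_of_proper_coloring[OF graph])
  \<comment> \<open>The pair \<open>n + t\<close> and 1 attains the infimum; it is admissible since
    \<open>n + t\<close> is at least 2.\<close>
  then have "real (n + t) \<in> ?R"
    using assms(2) by (intro CollectI exI[of _ "int (n + t)"] exI[of _ 1]) auto
  moreover have "real (n + t) \<le> x" if xR: "x \<in> ?R" for x
  proof -
    obtain k d f where x: "x = real_of_int k / real_of_int d" "2 * d \<ge> 2"
      "circular_coloring k d ((mycielskian ^^ t) G) f"
      using xR by blast
    then have d: "1 \<le> d" by simp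
    have "(int n + int t) * d \<le> k"
      by (rule circular_coloring_iterated_lower_bound[OF assms(1,2) bound x(3) d])
    then have "real_of_int ((int n + int t) * d) \<le> real_of_int k" by (simp only: of_int_le_iff)
    then show ?thesis using x(1) d by (simp add: pos_le_divide_eq)
  qed
  ultimately have "Inf ?R = real (n + t)"
    by (rule cInf_eq_minimum)
  then show "circular_chromatic_number ((mycielskian ^^ t) G) = real (chromatic_number ((mycielskian ^^ t) G))"
    unfolding circular_chromatic_number_def chi .
qed

end
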